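(* Consider the exponential-family multi-armed bandit: a fixed sampling rule $\Lambda$ chooses at each step $j=1,\dots,n$ an arm $x_j\in\{e_1,\dots,e_p\}$ (identified with $i\in\{1,\dots,p\}$) from $\Lambda(\cdot\mid H_{j-1})$, and then $y_j$ is drawn, conditionally on the past and $x_j$, from the one-parameter exponential family with density $\exp(\eta y-b(\eta))h(y)$ (with respect to a fixed base measure) at natural parameter $\eta=x_j^\top\beta_0$. Let $N_{n,i}$ be the number of pulls of arm $i$ in the first $n$ steps, $\bar Y_{n,i}=\frac1{N_{n,i}}\sum_{j=1}^n \mathbf{1}[x_j=e_i]y_j$, the local MLE $\hat\beta_{n,i}=\beta_{0,i}+\frac{\bar Y_{n,i}-b'(\beta_{0,i})}{b''(\beta_{0,i})}$, $\hat\beta_n=(\hat\beta_{n,1},\dots,\hat\beta_{n,p})$, and $I_n=\mathrm{diag}\{N_{n,i}\,b''(\beta_{0,i})\}_{i=1}^p$. Assume: (i) each $\beta_{0,i}$ lies in the interior of the natural parameter space; (ii) $\min_i N_{n,i}\xrightarrow{p}\infty$; (iii) the prior $\pi$ has a continuous and bounded density with $\pi(\beta_0)>0$. Then $$\big\|\pi(\cdot\mid H_n)-\mathcal{N}(\hat\beta_n,I_n^{-1})\big\|_{\mathrm{TV}}\xrightarrow{p}0.$$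
   Context: $H_j=((x_1,y_1),\dots,(x_j,y_j))$ is the history and the sampling rule $\Lambda$ maps any finite history to a probability distribution on $\{e_1,\dots,e_p\}$, and does not depend on $n$. The natural parameter space is $\{\eta:\int e^{\eta y}h(y)\,dy<\infty\}$ (integral w.r.t. the base measure), and $b$ is the log-partition function. The posterior is $\pi(\beta\mid H_n)\propto\pi(\beta)\prod_{j=1}^n\exp\big((x_j^\top\beta)y_j-b(x_j^\top\beta)\big)$ for $\beta$ with all coordinates in the natural parameter space (and the prior is supported there). $\|\cdot\|_{\mathrm{TV}}$ is total variation distance. *)

theory Defs
  imports "HOL-Probability.Probability"
begin

definition ef_partition :: "(real \<Rightarrow> real) \<Rightarrow> real measure \<Rightarrow> real \<Rightarrow> ennreal" where
  "ef_partition h \<mu> \<eta> = (\<integral>\<^sup>+ y. ennreal (exp (\<eta> * y) * h y) \<partial>\<mu>)"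

definition natspace :: "(real \<Rightarrow> real) \<Rightarrow> real measure \<Rightarrow> real set" where
  "natspace h \<mu> = {\<eta>. ef_partition h \<mu> \<eta> < \<infinity>}"

definition lognorm :: "(real \<Rightarrow> real) \<Rightarrow> real measure \<Rightarrow> real \<Rightarrow> real" where
  "lognorm h \<mu> \<eta> = ln (enn2real (ef_partition h \<mu> \<eta>))"

definition obs_space :: "real measure \<Rightarrow> ('p \<times> real) measure" where
  "obs_space \<mu> = count_space UNIV \<Otimes>\<^sub>M \<mu>"

definition bandit_step ::
  "(real \<Rightarrow> real) \<Rightarrow> real measure \<Rightarrow> real ^ 'p \<Rightarrow> (('p \<times> real) list \<Rightarrow> 'p pmf)
    \<Rightarrow> ('p \<times> real) list \<Rightarrow> ('p \<times> real) measure" where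
  "bandit_step h \<mu> \<beta>0 \<Lambda> H =
     measure_pmf (\<Lambda> H) \<bind>
       (\<lambda>i. distr (density \<mu> (\<lambda>y. ennreal (exp (\<beta>0 $ i * y - lognorm h \<mu> (\<beta>0 $ i)) * h y)))
                  (obs_space \<mu>) (\<lambda>y. (i, y)))"

text \<open>Law of the history H_n = ((x_1,y_1),...,(x_n,y_n)), encoded as a function on {..<n}
  (entry j is the (j+1)-th observation).\<close>
primrec bandit_hist ::
  "(real \<Rightarrow> real) \<Rightarrow> real measure \<Rightarrow> real ^ 'p \<Rightarrow> (('p \<times> real) list \<Rightarrow> 'p pmf)
    \<Rightarrow> nat \<Rightarrow> (nat \<Rightarrow> 'p \<times> real) measure" where
  "bandit_hist h \<mu> \<beta>0 \<Lambda> 0 = return (PiM {} (\<lambda>_. obs_space \<mu>)) (\<lambda>_. undefined)"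
| "bandit_hist h \<mu> \<beta>0 \<Lambda> (Suc n) =
     bandit_hist h \<mu> \<beta>0 \<Lambda> n \<bind>
       (\<lambda>\<omega>. distr (bandit_step h \<mu> \<beta>0 \<Lambda> (map \<omega> [0..<n]))
                  (PiM {..<Suc n} (\<lambda>_. obs_space \<mu>)) (\<lambda>z. fun_upd \<omega> n z))"

definition num_pulls :: "nat \<Rightarrow> (nat \<Rightarrow> 'p \<times> real) \<Rightarrow> 'p \<Rightarrow> nat" where
  "num_pulls n \<omega> i = card {j. j < n \<and> fst (\<omega> j) = i}"

definition ybar :: "nat \<Rightarrow> (nat \<Rightarrow> 'p \<times> real) \<Rightarrow> 'p \<Rightarrow> real" where
  "ybar n \<omega> i = (\<Sum>j\<in>{j. j < n \<and> fst (\<omega> j) = i}. snd (\<omega> j)) / real (num_pulls n \<omega> i)"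

definition local_mle ::
  "(real \<Rightarrow> real) \<Rightarrow> real measure \<Rightarrow> real ^ 'p \<Rightarrow> nat \<Rightarrow> (nat \<Rightarrow> 'p \<times> real) \<Rightarrow> real ^ 'p" where
  "local_mle h \<mu> \<beta>0 n \<omega> = (\<chi> i. \<beta>0 $ i +
      (ybar n \<omega> i - deriv (lognorm h \<mu>) (\<beta>0 $ i)) / deriv (deriv (lognorm h \<mu>)) (\<beta>0 $ i))"

text \<open>N(hat beta_n, I_n^{-1}) with I_n = diag(N_{n,i} b''(beta_{0,i})).\<close>
definition gauss_approx ::
  "(real \<Rightarrow> real) \<Rightarrow> real measure \<Rightarrow> real ^ 'p \<Rightarrow> nat \<Rightarrow> (nat \<Rightarrow> 'p \<times> real) \<Rightarrow> (real ^ 'p) measure" where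
  "gauss_approx h \<mu> \<beta>0 n \<omega> = density lborel (\<lambda>\<beta>. ennreal (\<Prod>i\<in>UNIV.
      normal_density (local_mle h \<mu> \<beta>0 n \<omega> $ i)
        (sqrt (1 / (real (num_pulls n \<omega> i) * deriv (deriv (lognorm h \<mu>)) (\<beta>0 $ i)))) (\<beta> $ i)))"

definition likelihood ::
  "(real \<Rightarrow> real) \<Rightarrow> real measure \<Rightarrow> nat \<Rightarrow> (nat \<Rightarrow> 'p \<times> real) \<Rightarrow> real ^ 'p \<Rightarrow> real" where
  "likelihood h \<mu> n \<omega> \<beta> =
     (\<Prod>j<n. exp (\<beta> $ fst (\<omega> j) * snd (\<omega> j) - lognorm h \<mu> (\<beta> $ fst (\<omega> j))))"

definition posterior ::
  "(real \<Rightarrow> real) \<Rightarrow> real measure \<Rightarrow> (real ^ 'p \<Rightarrow> real) \<Rightarrow> nat \<Rightarrow> (nat \<Rightarrow> 'p \<times> real)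
     \<Rightarrow> (real ^ 'p) measure" where
  "posterior h \<mu> prior n \<omega> = density lborel (\<lambda>\<beta>. ennreal
      (prior \<beta> * likelihood h \<mu> n \<omega> \<beta> /
       (\<integral>\<beta>'. prior \<beta>' * likelihood h \<mu> n \<omega> \<beta>' \<partial>lborel)))"

definition tv_dist :: "'a measure \<Rightarrow> 'a measure \<Rightarrow> real" where
  "tv_dist M N = (SUP A\<in>sets M. \<bar>measure M A - measure N A\<bar>)"

end

theory Submission
  imports Defs "HOL-Real_Asymp.Real_Asymp"
begin

text \<open>
  Write \<open>S\<close> for the centred reward sum and \<open>N\<close> for the number of pulls of an arm. Under adaptive
  sampling \<open>S / sqrt N\<close> need not be tight, so no central limit theorem is available; it is enough
  that \<open>\<bar>S\<bar> \<le> N powr (5/8)\<close> with high probability once \<open>N\<close> is large. The likelihood ratio of the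
  parameter \<open>\<beta>0 + l e\<^sub>i\<close> against \<open>\<beta>0\<close> has expectation 1 at every time \<open>n\<close>, whatever the sampling
  rule. Markov's inequality with \<open>l\<close> of order \<open>m powr (-3/8)\<close> then bounds the probability of
  \<open>N = m\<close> and \<open>\<bar>S\<bar> > m powr (5/8)\<close> by \<open>2 exp (- c m powr (1/4))\<close>, which is summable in \<open>m\<close>.

  On the remaining event the statement is deterministic. The likelihood factorises over the arms.
  Since \<open>5/8 < 2/3\<close>, the cubic remainder of the log-likelihood is negligible on a neighbourhood
  carrying almost all the mass, and convexity of the log-partition function controls the rest, so
  each factor is close in \<open>L\<^sup>1\<close> to its Gaussian. The product of the Gaussians concentrates at
  \<open>\<beta>0\<close>, where the prior is continuous and positive, so the prior acts as a constant.
\<close>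

section \<open>One-dimensional Laplace approximation\<close>

lemma nn_integral_exp_neg_atLeast:
  fixes k \<rho> :: real
  assumes "0 < k"
  shows "(\<integral>\<^sup>+x. ennreal (exp (- k * x)) * indicator {\<rho>..} x \<partial>lborel) = ennreal (exp (- k * \<rho>) / k)"
proof -
  have "(\<integral>\<^sup>+x. ennreal (exp (- k * x)) * indicator {\<rho>..} x \<partial>lborel)
      = ennreal (0 - (- exp (- k * \<rho>) / k))"
  proof (rule nn_integral_FTC_atLeast)
    show "((\<lambda>x. - exp (- k * x) / k) \<longlongrightarrow> 0) at_top"
      using assms by real_asymp
  qed (use assms in \<open>auto intro!: derivative_eq_intros\<close>)
  then show ?thesis by simp
qed

lemma nn_integral_exp_neg_abs_tail:
  fixes k \<rho> :: real
  assumes "0 < k"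
  shows "(\<integral>\<^sup>+x. ennreal (exp (- k * \<bar>x\<bar>)) * indicator {x. \<rho> \<le> \<bar>x\<bar>} x \<partial>lborel)
    \<le> ennreal (2 * exp (- k * \<rho>) / k)"
proof -
  let ?g = "\<lambda>x. ennreal (exp (- k * x)) * indicator {\<rho>..} x"
  have "(\<integral>\<^sup>+x. ennreal (exp (- k * \<bar>x\<bar>)) * indicator {x. \<rho> \<le> \<bar>x\<bar>} x \<partial>lborel)
      \<le> (\<integral>\<^sup>+x. ?g x + ?g (- x) \<partial>lborel)"
    by (intro nn_integral_mono) (auto simp: indicator_def abs_if)
  also have "\<dots> = (\<integral>\<^sup>+x. ?g x \<partial>lborel) + (\<integral>\<^sup>+x. ?g (- x) \<partial>lborel)"
    by (rule nn_integral_add) auto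
  also have "(\<integral>\<^sup>+x. ?g (- x) \<partial>lborel) = (\<integral>\<^sup>+x. ?g x \<partial>lborel)"
    using nn_integral_real_affine[of ?g "-1" 0] by simp
  also have "(\<integral>\<^sup>+x. ?g x \<partial>lborel) = ennreal (exp (- k * \<rho>) / k)"
    by (rule nn_integral_exp_neg_atLeast[OF assms])
  finally show ?thesis using assms by (simp flip: ennreal_plus)
qed

text \<open>Since \<open>\<Psi> 0 = 0\<close>, the exponent \<open>S * x - N * \<Psi> x\<close> is
  concave on \<open>D\<close> and vanishes at 0, so its slope seen from the origin decreases along
  each ray. A linear bound at \<open>\<rho>\<close> and \<open>- \<rho>\<close> therefore persists
  further out.\<close>

lemma convex_dominates_linear:
  fixes \<Psi> :: "real \<Rightarrow> real"
  assumes cvx: "convex_on D \<Psi>" and D: "0 \<in> D" "\<rho> \<in> D" "- \<rho> \<in> D" "x \<in> D"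
    and "\<Psi> 0 = 0" "0 < \<rho>" "0 < N" "\<rho> \<le> \<bar>x\<bar>"
    and r: "S * \<rho> - N * \<Psi> \<rho> \<le> - k * \<rho>" and l: "- S * \<rho> - N * \<Psi> (- \<rho>) \<le> - k * \<rho>"
  shows "S * x - N * \<Psi> x \<le> - k * \<bar>x\<bar>"
proof -
  define t where "t = \<rho> / \<bar>x\<bar>"
  define y where "y = sgn x * \<rho>"
  have x0: "x \<noteq> 0" using assms by auto
  have t: "0 < t" "t \<le> 1" and xt: "t * \<bar>x\<bar> = \<rho>" using assms x0 by (auto simp: t_def)
  have y: "t * x = y" using xt x0 by (auto simp: y_def sgn_if abs_if)
  have "\<Psi> ((1 - t) *\<^sub>R 0 + t *\<^sub>R x) \<le> (1 - t) * \<Psi> 0 + t * \<Psi> x"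
    using t D by (intro convex_onD[OF cvx]) auto
  then have "\<Psi> y \<le> t * \<Psi> x" using y \<open>\<Psi> 0 = 0\<close> by simp
  then have *: "N * \<Psi> y \<le> N * (t * \<Psi> x)" using \<open>0 < N\<close> by simp
  have "S * y - N * \<Psi> y \<le> - k * \<rho>"
    using r l x0 by (auto simp: y_def sgn_if)
  with * have "S * (t * x) - N * (t * \<Psi> x) \<le> - k * (t * \<bar>x\<bar>)"
    unfolding y xt by linarith
  then have "t * (S * x - N * \<Psi> x) \<le> t * (- k * \<bar>x\<bar>)"
    by (simp add: algebra_simps)
  then show ?thesis using t by (simp only: mult_le_cancel_left_pos)
qed

text \<open>Completing the square. The likelihood factor is later divided by the same denominator,
  so the two densities can be compared through their exponents alone.\<close>

lemma normal_density_eq_exp: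
  fixes N v S x :: real
  assumes "0 < N" "0 < v"
  shows "normal_density (S / (N * v)) (sqrt (1 / (N * v))) x
    = exp (S * x - N * (v * x\<^sup>2 / 2)) / (sqrt (2 * pi / (N * v)) * exp (S\<^sup>2 / (2 * N * v)))"
proof -
  have "- (x - S / (N * v))\<^sup>2 / (2 * (sqrt (1 / (N * v)))\<^sup>2)
      = S * x - N * (v * x\<^sup>2 / 2) - S\<^sup>2 / (2 * N * v)"
    using assms by (simp add: power2_eq_square field_simps)
  then show ?thesis using assms
    by (simp add: normal_density_def exp_diff)
qed

text \<open>Near 0 the cubic remainder contributes a factor close to 1, and \<open>N * \<rho> ^ 3\<close> is small for
  \<open>\<rho> = N powr (- 7 / 20)\<close>; beyond \<open>\<rho>\<close> concavity forces both exponents below \<open>- k * \<bar>x\<bar>\<close>.\<close>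

lemma laplace_approximation:
  fixes \<Psi> :: "real \<Rightarrow> real" and v C r r' \<epsilon> :: real
  assumes cvx: "convex_on D \<Psi>" and Dm[measurable]: "D \<in> sets borel"
    and Pm[measurable]: "\<Psi> \<in> borel_measurable borel"
    and "0 < v" "0 < C" "0 < r" "0 < r'" "0 < \<epsilon>"
    and bound': "\<forall>x. \<bar>x\<bar> \<le> r \<longrightarrow> x \<in> D \<and> \<bar>\<Psi> x - v * x\<^sup>2 / 2\<bar> \<le> C * \<bar>x\<bar> ^ 3"
  shows "\<forall>\<^sub>F N in at_top. \<forall>S. \<bar>S\<bar> \<le> N powr (5/8) \<longrightarrow>
    (\<integral>\<^sup>+x. ennreal \<bar>indicator D x * exp (S * x - N * \<Psi> x)
          / (sqrt (2 * pi / (N * v)) * exp (S\<^sup>2 / (2 * N * v)))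
        - normal_density (S / (N * v)) (sqrt (1 / (N * v))) x\<bar> \<partial>lborel) \<le> ennreal \<epsilon> \<and>
    (\<integral>\<^sup>+x. ennreal (normal_density (S / (N * v)) (sqrt (1 / (N * v))) x)
        * indicator {x. r' \<le> \<bar>x\<bar>} x \<partial>lborel) \<le> ennreal \<epsilon>"
proof -
  note bound = bound'[rule_format]
  \<comment> \<open>The exponent has to lie strictly between 1/3 and 3/8:
    \<open>N * \<rho> N ^ 3\<close> must tend to 0, while the curvature term
    \<open>N * (\<rho> N)\<^sup>2\<close> must dominate the drift
    \<open>N powr (5/8) * \<rho> N\<close>.\<close>
  define \<rho> where "\<rho> = (\<lambda>N::real. N powr (-(7/20)))"
  \<comment> \<open>\<open>k N * \<rho> N\<close> is a quarter of the quadratic exponent at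
    \<open>\<rho> N\<close>; the other three quarters absorb the linear and cubic terms for large
    \<open>N\<close>.\<close>
  define k where "k = (\<lambda>N. v / 8 * N * \<rho> N)"
  have e1: "\<forall>\<^sub>F N in at_top. \<rho> N \<le> r \<and> \<rho> N \<le> r'"
    unfolding \<rho>_def using \<open>0 < r\<close> \<open>0 < r'\<close> by (intro eventually_conj; real_asymp)
  have e2: "\<forall>\<^sub>F N in at_top. N powr (5/8) * \<rho> N - N * (v * (\<rho> N)\<^sup>2 / 2 - C * \<rho> N ^ 3) \<le> - k N * \<rho> N"
    unfolding \<rho>_def k_def using \<open>0 < v\<close> \<open>0 < C\<close> by real_asymp
  \<comment> \<open>The summands are the relative error on the window and the mass of the tails.
    \<open>k N * \<rho> N\<close> is of order \<open>N powr (3/10)\<close>, so its exponential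
    outweighs \<open>sqrt (N * v)\<close>.\<close>
  have "((\<lambda>N. (exp (C * N * \<rho> N ^ 3) - 1) + 2 * sqrt (N * v) * (2 * exp (- k N * \<rho> N) / k N)) \<longlongrightarrow> 0) at_top"
    unfolding \<rho>_def k_def using \<open>0 < v\<close> \<open>0 < C\<close> by real_asymp
  then have e3: "\<forall>\<^sub>F N in at_top. (exp (C * N * \<rho> N ^ 3) - 1) + 2 * sqrt (N * v) * (2 * exp (- k N * \<rho> N) / k N) < \<epsilon>"
    using \<open>0 < \<epsilon>\<close> by (rule order_tendstoD)
  show ?thesis
    using e1 e2 e3 eventually_gt_at_top[of 0]
  proof eventually_elim
    case (elim N)
    note N = \<open>0 < N\<close>
    have \<rho>: "0 < \<rho> N" "\<rho> N \<le> r" "\<rho> N \<le> r'" using elim by (auto simp: \<rho>_def)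
    have k: "0 < k N" using \<rho> N \<open>0 < v\<close> by (auto simp: k_def)
    define E where "E = exp (C * N * \<rho> N ^ 3) - 1"
    have E: "0 \<le> E" using \<open>0 < C\<close> N \<rho> by (simp add: E_def)
    define T where "T = 2 * exp (- k N * \<rho> N) / k N"
    have T: "0 \<le> T" using k by (simp add: T_def)
    show ?case
    proof (intro allI impI)
      fix S :: real assume S: "\<bar>S\<bar> \<le> N powr (5/8)"
      define K where "K = sqrt (2 * pi / (N * v)) * exp (S\<^sup>2 / (2 * N * v))"
      define f where "f = (\<lambda>x. indicator D x * exp (S * x - N * \<Psi> x) / K)"
      define \<phi> where "\<phi> = (\<lambda>x. normal_density (S / (N * v)) (sqrt (1 / (N * v))) x)"
      have [measurable]: "\<phi> \<in> borel_measurable borel" "f \<in> borel_measurable borel"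
        unfolding \<phi>_def f_def by measurable
      have \<phi>: "\<phi> x = exp (S * x - N * (v * x\<^sup>2 / 2)) / K" for x
        unfolding \<phi>_def K_def using N \<open>0 < v\<close> by (rule normal_density_eq_exp)
      have K: "0 < K" using N \<open>0 < v\<close> by (auto simp: K_def)
      have iK: "1 / K \<le> sqrt (N * v)"
      proof -
        have "1 * 1 \<le> sqrt (2 * pi) * exp (S\<^sup>2 / (2 * N * v))"
          using N \<open>0 < v\<close> pi_ge_two by (intro mult_mono) auto
        then have "1 \<le> sqrt (N * v) * K"
          using N \<open>0 < v\<close> by (simp add: K_def real_sqrt_divide)
        then show ?thesis using K by (simp add: field_simps)
      qed
      have Sr: "\<bar>S * \<rho> N\<bar> \<le> N powr (5/8) * \<rho> N"
        using S \<rho> by (simp add: abs_mult)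
      have Psi: "N * \<Psi> x \<ge> N * (v * (\<rho> N)\<^sup>2 / 2 - C * \<rho> N ^ 3)" if "\<bar>x\<bar> = \<rho> N" for x
      proof (rule mult_left_mono)
        have "x\<^sup>2 = (\<rho> N)\<^sup>2" using that by (metis power2_abs)
        then show "v * (\<rho> N)\<^sup>2 / 2 - C * \<rho> N ^ 3 \<le> \<Psi> x"
          using bound[of x] that \<rho> by auto
      qed (use N in simp)
      have P0: "\<Psi> 0 = 0" "0 \<in> D" using bound[of 0] \<open>0 < r\<close> by auto
      have cvx2: "convex_on UNIV (\<lambda>x::real. v * x\<^sup>2 / 2)"
        using convex_on_cmul[of "v/2" UNIV "\<lambda>x::real. x\<^sup>2"] convex_power2 \<open>0 < v\<close> by simp
      \<comment> \<open>The Gaussian exponent has no cubic remainder, so the boundary estimate made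
        for \<open>\<Psi>\<close> holds for it a fortiori.\<close>
      have "N * (v * (\<rho> N)\<^sup>2 / 2) \<ge> N * (v * (\<rho> N)\<^sup>2 / 2 - C * \<rho> N ^ 3)"
        using N \<rho> \<open>0 < C\<close> by (intro mult_left_mono) auto
      then have q: "S * \<rho> N - N * (v * (\<rho> N)\<^sup>2 / 2) \<le> - k N * \<rho> N"
        "- S * \<rho> N - N * (v * (- \<rho> N)\<^sup>2 / 2) \<le> - k N * \<rho> N"
        using Sr elim(2) unfolding power2_minus by linarith+
      have tail\<phi>: "\<phi> x \<le> sqrt (N * v) * exp (- k N * \<bar>x\<bar>)" if "\<rho> N \<le> \<bar>x\<bar>" for x
      proof -
        have "S * x - N * (v * x\<^sup>2 / 2) \<le> - k N * \<bar>x\<bar>"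
          by (rule convex_dominates_linear[OF cvx2, where \<rho> = "\<rho> N"])
             (use that \<rho> N q in auto)
        then have "exp (S * x - N * (v * x\<^sup>2 / 2)) * (1 / K) \<le> exp (- k N * \<bar>x\<bar>) * sqrt (N * v)"
          using iK K by (intro mult_mono) auto
        then show ?thesis by (simp add: \<phi> mult.commute)
      qed
      have tailf: "f x \<le> sqrt (N * v) * exp (- k N * \<bar>x\<bar>)" if "\<rho> N \<le> \<bar>x\<bar>" for x
      proof (cases "x \<in> D")
        case True
        have "S * \<rho> N - N * \<Psi> (\<rho> N) \<le> - k N * \<rho> N"
          using Psi[of "\<rho> N"] \<rho>(1) Sr elim(2) by linarith
        moreover have "- S * \<rho> N - N * \<Psi> (- \<rho> N) \<le> - k N * \<rho> N"
          using Psi[of "- \<rho> N"] \<rho>(1) Sr elim(2) by linarith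
        ultimately have "S * x - N * \<Psi> x \<le> - k N * \<bar>x\<bar>"
          by (intro convex_dominates_linear[OF cvx, where \<rho> = "\<rho> N"])
             (use that True \<rho> N P0 bound[of "\<rho> N"] bound[of "- \<rho> N"] in auto)
        then have "exp (S * x - N * \<Psi> x) * (1 / K) \<le> exp (- k N * \<bar>x\<bar>) * sqrt (N * v)"
          using iK K by (intro mult_mono) auto
        then show ?thesis using True by (simp add: f_def mult.commute)
      qed (use N \<open>0 < v\<close> in \<open>simp add: f_def\<close>)
      have f0: "0 \<le> f x" "0 \<le> \<phi> x" for x using K by (auto simp: f_def \<phi>)
      have mid: "\<bar>f x - \<phi> x\<bar> \<le> E * \<phi> x" if "\<bar>x\<bar> \<le> \<rho> N" for x
      proof -
        have xr: "\<bar>x\<bar> \<le> r" using that \<rho> by simp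
        define R where "R = N * (v * x\<^sup>2 / 2 - \<Psi> x)"
        have "\<bar>R\<bar> \<le> N * (C * \<bar>x\<bar> ^ 3)"
          unfolding R_def abs_mult using bound[OF xr] N by (auto simp: abs_minus_commute)
        also have "\<dots> \<le> N * (C * \<rho> N ^ 3)"
          using N \<open>0 < C\<close> that by (intro mult_left_mono power_mono) auto
        finally have R: "\<bar>R\<bar> \<le> C * N * \<rho> N ^ 3" by (simp add: mult_ac)
        have "f x = exp R * \<phi> x"
          using bound[OF xr] by (simp add: f_def \<phi> R_def algebra_simps flip: exp_add)
        then have "\<bar>f x - \<phi> x\<bar> = \<bar>exp R - 1\<bar> * \<phi> x"
          using f0(2)[of x] by (metis abs_mult abs_of_nonneg left_diff_distrib mult_1)
        \<comment> \<open>For negative \<open>R\<close> this amounts to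
          \<open>exp R + exp (- R) \<ge> 2\<close>.\<close>
        also have "\<bar>exp R - 1\<bar> \<le> exp \<bar>R\<bar> - 1"
        proof (cases "0 \<le> R")
          case False
          have "2 \<le> exp R + exp (- R)"
            using exp_ge_add_one_self[of R] exp_ge_add_one_self[of "-R"] by linarith
          then show ?thesis using False by (simp add: abs_if)
        qed simp
        also have "\<dots> \<le> E" unfolding E_def using R by simp
        finally show ?thesis using f0 by (simp add: mult_right_mono)
      qed
      let ?tl = "\<lambda>x. ennreal (exp (- k N * \<bar>x\<bar>)) * indicator {x. \<rho> N \<le> \<bar>x\<bar>} x"
      have intt: "(\<integral>\<^sup>+x. ?tl x \<partial>lborel) \<le> ennreal T"
        unfolding T_def by (rule nn_integral_exp_neg_abs_tail[OF k])
      have int\<phi>: "(\<integral>\<^sup>+x. ennreal (\<phi> x) \<partial>lborel) = 1"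
      proof -
        interpret prob_space "density lborel (normal_density (S / (N * v)) (sqrt (1 / (N * v))))"
          using N \<open>0 < v\<close> by (intro prob_space_normal_density) auto
        show ?thesis using emeasure_space_1 by (simp add: emeasure_density \<phi>_def)
      qed
      have s0: "0 \<le> sqrt (N * v)" using N \<open>0 < v\<close> by simp
      have "(\<integral>\<^sup>+x. ennreal \<bar>f x - \<phi> x\<bar> \<partial>lborel)
          \<le> (\<integral>\<^sup>+x. ennreal E * ennreal (\<phi> x) + ennreal (2 * sqrt (N * v)) * ?tl x \<partial>lborel)"
      proof (rule nn_integral_mono)
        fix x :: real
        show "ennreal \<bar>f x - \<phi> x\<bar> \<le> ennreal E * ennreal (\<phi> x) + ennreal (2 * sqrt (N * v)) * ?tl x"
        proof (cases "\<bar>x\<bar> < \<rho> N")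
          case True
          then show ?thesis using mid[of x] E f0 by (simp add: ennreal_leI flip: ennreal_mult)
        next
          case False
          have "\<bar>f x - \<phi> x\<bar> \<le> 2 * sqrt (N * v) * exp (- k N * \<bar>x\<bar>)"
            using f0[of x] tailf[of x] tail\<phi>[of x] False by linarith
          then have "ennreal \<bar>f x - \<phi> x\<bar> \<le> ennreal (2 * sqrt (N * v)) * ?tl x"
            using False s0 by (simp add: ennreal_leI flip: ennreal_mult)
          then show ?thesis by (simp add: add_increasing)
        qed
      qed
      also have "\<dots> = ennreal E * (\<integral>\<^sup>+x. ennreal (\<phi> x) \<partial>lborel) + ennreal (2 * sqrt (N * v)) * (\<integral>\<^sup>+x. ?tl x \<partial>lborel)"
        by (subst nn_integral_add; (subst nn_integral_cmult)?; (subst nn_integral_cmult)?) auto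
      also have "\<dots> \<le> ennreal E * 1 + ennreal (2 * sqrt (N * v)) * ennreal T"
        unfolding int\<phi> by (intro add_mono mult_left_mono intt) auto
      also have "\<dots> = ennreal (E + 2 * sqrt (N * v) * T)"
        using E T s0 by (simp flip: ennreal_mult ennreal_plus)
      also have "\<dots> \<le> ennreal \<epsilon>"
        using elim(3) by (intro ennreal_leI) (simp add: E_def T_def)
      finally have 1: "(\<integral>\<^sup>+x. ennreal \<bar>f x - \<phi> x\<bar> \<partial>lborel) \<le> ennreal \<epsilon>" .
      have "(\<integral>\<^sup>+x. ennreal (\<phi> x) * indicator {x. r' \<le> \<bar>x\<bar>} x \<partial>lborel)
          \<le> (\<integral>\<^sup>+x. ennreal (sqrt (N * v)) * ?tl x \<partial>lborel)"
        using \<rho> s0 tail\<phi> by (intro nn_integral_mono)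
          (auto simp: indicator_def ennreal_leI simp flip: ennreal_mult)
      also have "\<dots> = ennreal (sqrt (N * v)) * (\<integral>\<^sup>+x. ?tl x \<partial>lborel)"
        by (rule nn_integral_cmult) auto
      also have "\<dots> \<le> ennreal (sqrt (N * v)) * ennreal T"
        by (intro mult_left_mono intt) auto
      also have "\<dots> = ennreal (sqrt (N * v) * T)"
        using T s0 by (simp flip: ennreal_mult)
      also have "\<dots> \<le> ennreal \<epsilon>"
      proof (rule ennreal_leI)
        have "sqrt (N * v) * T \<le> E + 2 * sqrt (N * v) * T"
          using mult_nonneg_nonneg[OF s0 T] E by linarith
        then show "sqrt (N * v) * T \<le> \<epsilon>" using elim(3) by (simp add: E_def T_def)
      qed
      finally have 2: "(\<integral>\<^sup>+x. ennreal (\<phi> x) * indicator {x. r' \<le> \<bar>x\<bar>} x \<partial>lborel) \<le> ennreal \<epsilon>" .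
      show "(\<integral>\<^sup>+x. ennreal \<bar>indicator D x * exp (S * x - N * \<Psi> x)
          / (sqrt (2 * pi / (N * v)) * exp (S\<^sup>2 / (2 * N * v)))
        - normal_density (S / (N * v)) (sqrt (1 / (N * v))) x\<bar> \<partial>lborel) \<le> ennreal \<epsilon> \<and>
        (\<integral>\<^sup>+x. ennreal (normal_density (S / (N * v)) (sqrt (1 / (N * v))) x)
        * indicator {x. r' \<le> \<bar>x\<bar>} x \<partial>lborel) \<le> ennreal \<epsilon>"
        using 1 2 unfolding f_def \<phi>_def K_def by blast
    qed
  qed
qed

section \<open>Total variation and products of densities\<close>

text \<open>On each event the difference of the measures is an integral of \<open>p - q\<close>. The
  factor 1/2 available for probability densities is given up, which is harmless for a limit.\<close>

lemma tv_dist_density_le: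
  fixes p q :: "'a \<Rightarrow> real"
  assumes p: "integrable M p" "\<And>x. 0 \<le> p x" and q: "integrable M q" "\<And>x. 0 \<le> q x"
  shows "tv_dist (density M p) (density M q) \<le> (\<integral>x. \<bar>p x - q x\<bar> \<partial>M)"
  unfolding tv_dist_def
proof (rule cSUP_least)
  fix A assume "A \<in> sets (density M p)"
  then have A[measurable]: "A \<in> sets M" by simp
  have m: "measure (density M f) A = (\<integral>x. indicator A x * f x \<partial>M)"
    and i: "integrable M (\<lambda>x. indicator A x * f x)"
    if f: "integrable M f" "\<And>x. 0 \<le> f x" for f :: "'a \<Rightarrow> real"
  proof -
    show i: "integrable M (\<lambda>x. indicator A x * f x)"
      using integrable_mult_indicator[OF A f(1)] by simp
    have "emeasure (density M f) A = (\<integral>\<^sup>+x. ennreal (indicator A x * f x) \<partial>M)"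
      using f by (subst emeasure_density) (auto intro!: nn_integral_cong simp: indicator_def)
    also have "\<dots> = ennreal (\<integral>x. indicator A x * f x \<partial>M)"
      using f by (intro nn_integral_eq_integral[OF i]) (auto simp: indicator_def)
    finally show "measure (density M f) A = (\<integral>x. indicator A x * f x \<partial>M)"
      using f by (simp add: measure_def integral_nonneg_AE)
  qed
  have "\<bar>measure (density M p) A - measure (density M q) A\<bar>
      = \<bar>\<integral>x. indicator A x * p x - indicator A x * q x \<partial>M\<bar>"
    by (simp add: m i p q)
  also have "\<dots> \<le> (\<integral>x. \<bar>indicator A x * p x - indicator A x * q x\<bar> \<partial>M)"
    by (rule integral_abs_bound)
  also have "\<dots> \<le> (\<integral>x. \<bar>p x - q x\<bar> \<partial>M)"
    using p q i by (intro integral_mono) (auto simp: indicator_def)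
  finally show "\<bar>measure (density M p) A - measure (density M q) A\<bar> \<le> (\<integral>x. \<bar>p x - q x\<bar> \<partial>M)" .
qed auto

text \<open>Tonelli's theorem for product integrands, with \<open>axis\<close> translating between
  basis vectors and coordinates.\<close>

lemma nn_integral_lborel_vec_prod:
  fixes f :: "'p::finite \<Rightarrow> real \<Rightarrow> ennreal"
  assumes [measurable]: "\<And>i. f i \<in> borel_measurable borel"
  shows "(\<integral>\<^sup>+x. (\<Prod>i\<in>UNIV. f i (x $ i)) \<partial>lborel) = (\<Prod>i\<in>UNIV. \<integral>\<^sup>+x. f i x \<partial>lborel)"
proof -
  let ?e = "\<lambda>i::'p. axis i (1::real)"
  have inj: "inj ?e" by (auto simp: inj_def axis_eq_axis)
  have B: "(Basis :: (real ^ 'p) set) = range ?e" by (auto simp: Basis_vec_def)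
  have "(\<integral>\<^sup>+x. (\<Prod>b\<in>Basis. f (inv ?e b) (x \<bullet> b)) \<partial>lborel)
      = (\<Prod>b\<in>Basis. \<integral>\<^sup>+x. f (inv ?e b) x \<partial>lborel)"
    by (intro nn_integral_lborel_prod) auto
  then show ?thesis
    unfolding B by (simp add: prod.reindex[OF inj] inv_f_f[OF inj] inner_axis)
qed

text \<open>Telescoping: the factors are exchanged one coordinate at a time, and each exchange costs
  one integrated difference times the masses of the remaining factors, each at most 2.\<close>

lemma nn_integral_prod_diff_le:
  fixes f g :: "'p::finite \<Rightarrow> real \<Rightarrow> real"
  assumes [measurable]: "\<And>i. f i \<in> borel_measurable borel" "\<And>i. g i \<in> borel_measurable borel"
    and nonneg: "\<And>i x. 0 \<le> f i x" "\<And>i x. 0 \<le> g i x"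
    and le2: "\<And>i. (\<integral>\<^sup>+x. ennreal (f i x) \<partial>lborel) \<le> 2" "\<And>i. (\<integral>\<^sup>+x. ennreal (g i x) \<partial>lborel) \<le> 2"
    and diff: "\<And>i. (\<integral>\<^sup>+x. ennreal \<bar>f i x - g i x\<bar> \<partial>lborel) \<le> e"
  shows "(\<integral>\<^sup>+x. ennreal \<bar>(\<Prod>i\<in>UNIV. f i (x $ i)) - (\<Prod>i\<in>UNIV. g i (x $ i))\<bar> \<partial>lborel)
    \<le> of_nat CARD('p) * (2 ^ CARD('p) * e)"
proof -
  \<comment> \<open>Hybrid family: coordinates in \<open>F\<close> already carry \<open>f\<close>,
    the others still carry \<open>g\<close>.\<close>
  define u where "u = (\<lambda>F i. if i \<in> F then f i else g i)"
  have [measurable]: "u F i \<in> borel_measurable borel" for F i by (simp add: u_def)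
  have "(\<integral>\<^sup>+x. ennreal \<bar>(\<Prod>i\<in>UNIV. u F i (x $ i)) - (\<Prod>i\<in>UNIV. g i (x $ i))\<bar> \<partial>lborel)
    \<le> of_nat (card F) * (2 ^ CARD('p) * e)" if "finite F" for F
    using that
  proof induction
    case empty
    then show ?case by (simp add: u_def)
  next
    case (insert k F)
    \<comment> \<open>Passing from \<open>F\<close> to \<open>insert k F\<close> changes only factor
      \<open>k\<close>, so the absolute difference of the two hybrid products is again a product,
      with factors \<open>w\<close>.\<close>
    define w where "w = (\<lambda>i x. if i = k then \<bar>f i x - g i x\<bar> else u F i x)"
    have [measurable]: "w i \<in> borel_measurable borel" for i by (simp add: w_def)
    have w0: "0 \<le> w i x" for i x using nonneg by (simp add: w_def u_def)
    have step: "\<bar>(\<Prod>i\<in>UNIV. u (insert k F) i (x $ i)) - (\<Prod>i\<in>UNIV. u F i (x $ i))\<bar> = (\<Prod>i\<in>UNIV. w i (x $ i))" for x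
    proof -
      let ?R = "\<Prod>i\<in>UNIV - {k}. u F i (x $ i)"
      have R: "0 \<le> ?R" using nonneg by (intro prod_nonneg) (simp add: u_def)
      have [simp]: "(\<Prod>i\<in>UNIV - {k}. u (insert k F) i (x $ i)) = ?R"
        "(\<Prod>i\<in>UNIV - {k}. w i (x $ i)) = ?R"
        by (auto simp: u_def w_def intro!: prod.cong)
      have "u (insert k F) k = f k" "u F k = g k" "w k (x $ k) = \<bar>f k (x $ k) - g k (x $ k)\<bar>"
        using insert.hyps by (simp_all add: u_def w_def)
      then show ?thesis using R
        by (simp add: prod.remove[of UNIV k] abs_mult flip: left_diff_distrib)
    qed
    have "(\<integral>\<^sup>+x. ennreal (\<Prod>i\<in>UNIV. w i (x $ i)) \<partial>lborel) = (\<Prod>i\<in>UNIV. \<integral>\<^sup>+x. ennreal (w i x) \<partial>lborel)"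
      using nn_integral_lborel_vec_prod[of "\<lambda>i x. ennreal (w i x)"] w0 by (simp add: prod_ennreal)
    also have "\<dots> = (\<integral>\<^sup>+x. ennreal \<bar>f k x - g k x\<bar> \<partial>lborel) * (\<Prod>i\<in>UNIV - {k}. \<integral>\<^sup>+x. ennreal (u F i x) \<partial>lborel)"
      by (subst prod.remove[of UNIV k]) (auto simp: w_def intro!: prod.cong arg_cong2[where f="(*)"] nn_integral_cong)
    also have "\<dots> \<le> e * (\<Prod>i\<in>UNIV - {k}. 2)"
    proof (intro mult_mono diff)
      have u2: "(\<integral>\<^sup>+x. ennreal (u F i x) \<partial>lborel) \<le> 2" for i
        using le2 by (cases "i \<in> F") (simp_all add: u_def)
      have le: "(\<Prod>i\<in>A. \<integral>\<^sup>+x. ennreal (u F i x) \<partial>lborel) \<le> (\<Prod>i\<in>A. 2)" if "finite A" for A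
        using that by induction (auto intro: mult_mono u2)
      show "(\<Prod>i\<in>UNIV - {k}. \<integral>\<^sup>+x. ennreal (u F i x) \<partial>lborel) \<le> (\<Prod>i\<in>UNIV - {k}. 2)"
        by (rule le) simp
    qed auto
    also have "\<dots> \<le> e * 2 ^ CARD('p)"
      by (intro mult_left_mono) (auto intro!: power_increasing)
    finally have *: "(\<integral>\<^sup>+x. ennreal (\<Prod>i\<in>UNIV. w i (x $ i)) \<partial>lborel) \<le> 2 ^ CARD('p) * e"
      by (simp add: mult.commute)
    have "(\<integral>\<^sup>+x. ennreal \<bar>(\<Prod>i\<in>UNIV. u (insert k F) i (x $ i)) - (\<Prod>i\<in>UNIV. g i (x $ i))\<bar> \<partial>lborel)
      \<le> (\<integral>\<^sup>+x. ennreal (\<Prod>i\<in>UNIV. w i (x $ i)) + ennreal \<bar>(\<Prod>i\<in>UNIV. u F i (x $ i)) - (\<Prod>i\<in>UNIV. g i (x $ i))\<bar> \<partial>lborel)"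
      unfolding step[symmetric]
      by (intro nn_integral_mono) (auto simp flip: ennreal_plus intro!: ennreal_leI)
    also have "\<dots> = (\<integral>\<^sup>+x. ennreal (\<Prod>i\<in>UNIV. w i (x $ i)) \<partial>lborel)
        + (\<integral>\<^sup>+x. ennreal \<bar>(\<Prod>i\<in>UNIV. u F i (x $ i)) - (\<Prod>i\<in>UNIV. g i (x $ i))\<bar> \<partial>lborel)"
      by (rule nn_integral_add) auto
    also have "\<dots> \<le> 2 ^ CARD('p) * e + of_nat (card F) * (2 ^ CARD('p) * e)"
      by (intro add_mono * insert.IH)
    finally show ?case using insert.hyps by (simp add: algebra_simps)
  qed
  from this[of UNIV] show ?thesis by (simp add: u_def)
qed

text \<open>Before normalisation three errors add up to \<open>\<theta>\<close>: exchanging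
  \<open>f\<close> for \<open>g\<close>, the variation of the prior near \<open>\<beta>0\<close>,
  and the mass of \<open>g\<close> outside the box of half-width \<open>r\<close>. \<open>w\<close>
  plays the unnormalised posterior; its constant \<open>K\<close> cancels on division by the
  integral.\<close>

lemma tv_dist_reweighted_product_le:
  fixes f g :: "'p::finite \<Rightarrow> real \<Rightarrow> real" and prior :: "real ^ 'p \<Rightarrow> real" and \<beta>0 :: "real ^ 'p"
    and B e \<tau> r \<theta> K :: real
  assumes [measurable]: "\<And>i. f i \<in> borel_measurable borel" "\<And>i. g i \<in> borel_measurable borel"
      "prior \<in> borel_measurable borel"
    and nonneg: "\<And>i x. 0 \<le> f i x" "\<And>i x. 0 \<le> g i x"
    and prior: "\<And>x. 0 \<le> prior x" "\<And>x. prior x \<le> B" "0 < prior \<beta>0"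
    and g1: "\<And>i. (\<integral>\<^sup>+x. ennreal (g i x) \<partial>lborel) = 1"
    and e: "0 \<le> e" "e \<le> 1" "0 \<le> \<tau>"
    and diff: "\<And>i. (\<integral>\<^sup>+x. ennreal \<bar>f i x - g i x\<bar> \<partial>lborel) \<le> ennreal e"
    and close: "\<And>x. (\<And>i. \<bar>x $ i - \<beta>0 $ i\<bar> < r) \<Longrightarrow> \<bar>prior x - prior \<beta>0\<bar> \<le> \<tau>"
    and tail: "\<And>i. (\<integral>\<^sup>+x. ennreal (g i x) * indicator {x. r \<le> \<bar>x - \<beta>0 $ i\<bar>} x \<partial>lborel) \<le> ennreal e"
    and \<theta>: "\<theta> = B * (CARD('p) * (2 ^ CARD('p) * e)) + (\<tau> + B * (CARD('p) * e))" "\<theta> \<le> prior \<beta>0 / 2"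
    and w: "0 < K" "\<And>x. w x = K * (prior x * (\<Prod>i\<in>UNIV. f i (x $ i)))"
  shows "tv_dist (density lborel (\<lambda>x. ennreal (w x / (\<integral>y. w y \<partial>lborel))))
      (density lborel (\<lambda>x. ennreal (\<Prod>i\<in>UNIV. g i (x $ i)))) \<le> 4 * \<theta> / prior \<beta>0"
proof -
  define G where "G = (\<lambda>x::real^'p. \<Prod>i\<in>UNIV. g i (x $ i))"
  define F where "F = (\<lambda>x::real^'p. \<Prod>i\<in>UNIV. f i (x $ i))"
  define q where "q = (\<lambda>x. prior x * F x)"
  define a where "a = prior \<beta>0"
  have [measurable]: "G \<in> borel_measurable borel" "F \<in> borel_measurable borel" "q \<in> borel_measurable borel"
    unfolding G_def F_def q_def by measurable
  have B: "0 \<le> B" using prior(1,2) order_trans by blast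
  have G0: "0 \<le> G x" and F0: "0 \<le> F x" and q0: "0 \<le> q x" for x
    using nonneg prior by (auto simp: G_def F_def q_def intro!: prod_nonneg mult_nonneg_nonneg)
  have Gint: "(\<integral>\<^sup>+x. ennreal (G x) \<partial>lborel) = 1"
    using nn_integral_lborel_vec_prod[of "\<lambda>i x. ennreal (g i x)"] nonneg
    by (simp add: G_def prod_ennreal g1)
  have f2: "(\<integral>\<^sup>+x. ennreal (f i x) \<partial>lborel) \<le> 2" for i
  proof -
    have "(\<integral>\<^sup>+x. ennreal (f i x) \<partial>lborel) \<le> (\<integral>\<^sup>+x. ennreal \<bar>f i x - g i x\<bar> + ennreal (g i x) \<partial>lborel)"
      using nonneg by (intro nn_integral_mono) (auto simp flip: ennreal_plus intro!: ennreal_leI)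
    also have "\<dots> = (\<integral>\<^sup>+x. ennreal \<bar>f i x - g i x\<bar> \<partial>lborel) + 1"
      by (subst nn_integral_add) (auto simp: g1)
    also have "\<dots> \<le> ennreal 1 + 1"
      using e by (intro add_mono order_trans[OF diff] ennreal_leI) auto
    finally show ?thesis by (simp add: one_add_one)
  qed
  have FG: "(\<integral>\<^sup>+x. ennreal \<bar>F x - G x\<bar> \<partial>lborel) \<le> ennreal (CARD('p) * (2 ^ CARD('p) * e))"
  proof -
    have "(\<integral>\<^sup>+x. ennreal \<bar>F x - G x\<bar> \<partial>lborel) \<le> of_nat CARD('p) * (2 ^ CARD('p) * ennreal e)"
      unfolding F_def G_def
      by (rule nn_integral_prod_diff_le) (use nonneg f2 diff in \<open>auto simp: g1 one_le_numeral\<close>)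
    also have "\<dots> = ennreal (CARD('p) * (2 ^ CARD('p) * e))"
      using e by (simp add: ennreal_mult ennreal_of_nat_eq_real_of_nat flip: ennreal_power)
    finally show ?thesis .
  qed
  have tailG: "(\<integral>\<^sup>+x. ennreal (G x) * indicator {x. r \<le> \<bar>x $ k - \<beta>0 $ k\<bar>} x \<partial>lborel) \<le> ennreal e" for k
  proof -
    let ?v = "\<lambda>i x. ennreal (g i x) * (if i = k then indicator {x. r \<le> \<bar>x - \<beta>0 $ i\<bar>} x else 1)"
    have "(\<integral>\<^sup>+x. ennreal (G x) * indicator {x. r \<le> \<bar>x $ k - \<beta>0 $ k\<bar>} x \<partial>lborel)
      = (\<integral>\<^sup>+x. (\<Prod>i\<in>UNIV. ?v i (x $ i)) \<partial>lborel)"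
      using nonneg by (intro nn_integral_cong)
        (auto simp: prod.distrib G_def prod_ennreal indicator_def)
    also have "\<dots> = (\<Prod>i\<in>UNIV. \<integral>\<^sup>+x. ?v i x \<partial>lborel)"
      by (rule nn_integral_lborel_vec_prod) measurable
    also have "\<dots> = (\<integral>\<^sup>+x. ?v k x \<partial>lborel)"
      by (subst prod.remove[of UNIV k]) (auto simp: g1)
    finally show ?thesis using tail[of k] by simp
  qed
  have priorG: "(\<integral>\<^sup>+x. ennreal (\<bar>prior x - a\<bar> * G x) \<partial>lborel) \<le> ennreal (\<tau> + B * (CARD('p) * e))"
  proof -
    \<comment> \<open>Union bound: a point outside the box is far from \<open>\<beta>0\<close> in at
      least one coordinate, and there the prior differs from \<open>a\<close> by at most
      \<open>B\<close>.\<close>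
    let ?t = "\<lambda>x. \<Sum>i\<in>UNIV. ennreal (G x) * indicator {x. r \<le> \<bar>x $ i - \<beta>0 $ i\<bar>} x"
    have "(\<integral>\<^sup>+x. ennreal (\<bar>prior x - a\<bar> * G x) \<partial>lborel)
       \<le> (\<integral>\<^sup>+x. ennreal \<tau> * ennreal (G x) + ennreal B * ?t x \<partial>lborel)"
    proof (rule nn_integral_mono)
      fix x :: "real ^ 'p"
      show "ennreal (\<bar>prior x - a\<bar> * G x) \<le> ennreal \<tau> * ennreal (G x) + ennreal B * ?t x"
      proof (cases "\<forall>i. \<bar>x $ i - \<beta>0 $ i\<bar> < r")
        case True
        then have "\<bar>prior x - a\<bar> * G x \<le> \<tau> * G x"
          using close[of x] G0 by (auto simp: a_def intro!: mult_right_mono)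
        then have "ennreal (\<bar>prior x - a\<bar> * G x) \<le> ennreal \<tau> * ennreal (G x)"
          using e G0 by (simp add: ennreal_leI flip: ennreal_mult)
        then show ?thesis by (simp add: add_increasing2)
      next
        case False
        then obtain k where k: "r \<le> \<bar>x $ k - \<beta>0 $ k\<bar>" by (auto simp: not_less)
        have "\<bar>prior x - a\<bar> \<le> B" unfolding a_def
          using prior(1)[of x] prior(2)[of x] prior(2)[of \<beta>0] prior(3) by linarith
        then have "\<bar>prior x - a\<bar> * G x \<le> B * G x" using G0 by (auto intro!: mult_right_mono)
        then have "ennreal (\<bar>prior x - a\<bar> * G x) \<le> ennreal B * ennreal (G x)"
          using B G0 by (simp add: ennreal_leI flip: ennreal_mult)
        also have "ennreal (G x) = ennreal (G x) * indicator {x. r \<le> \<bar>x $ k - \<beta>0 $ k\<bar>} x"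
          using k by simp
        also have "\<dots> \<le> ?t x" by (rule member_le_sum) auto
        finally show ?thesis by (simp add: add_increasing mult_left_mono)
      qed
    qed
    also have "\<dots> = ennreal \<tau> * (\<integral>\<^sup>+x. ennreal (G x) \<partial>lborel)
        + ennreal B * (\<Sum>i\<in>UNIV. \<integral>\<^sup>+x. ennreal (G x) * indicator {x. r \<le> \<bar>x $ i - \<beta>0 $ i\<bar>} x \<partial>lborel)"
      by (subst nn_integral_add; (subst nn_integral_cmult)?; (subst nn_integral_cmult)?; (subst nn_integral_sum)?; (rule refl | measurable)?)
    also have "\<dots> \<le> ennreal \<tau> * 1 + ennreal B * (\<Sum>i\<in>(UNIV::'p set). ennreal e)"
      unfolding Gint by (intro add_mono mult_left_mono sum_mono tailG) auto
    also have "\<dots> = ennreal (\<tau> + B * (CARD('p) * e))"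
      using e B by (simp add: ennreal_mult ennreal_of_nat_eq_real_of_nat)
    finally show ?thesis .
  qed
  have main: "(\<integral>\<^sup>+x. ennreal \<bar>q x - a * G x\<bar> \<partial>lborel) \<le> ennreal \<theta>"
  proof -
    have "(\<integral>\<^sup>+x. ennreal \<bar>q x - a * G x\<bar> \<partial>lborel)
        \<le> (\<integral>\<^sup>+x. ennreal B * ennreal \<bar>F x - G x\<bar> + ennreal (\<bar>prior x - a\<bar> * G x) \<partial>lborel)"
    proof (rule nn_integral_mono)
      fix x :: "real ^ 'p"
      have "q x - a * G x = prior x * (F x - G x) + (prior x - a) * G x"
        by (simp add: q_def algebra_simps)
      then have "\<bar>q x - a * G x\<bar> \<le> prior x * \<bar>F x - G x\<bar> + \<bar>prior x - a\<bar> * G x"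
        using abs_triangle_ineq[of "prior x * (F x - G x)" "(prior x - a) * G x"] prior G0
        by (simp add: abs_mult)
      also have "\<dots> \<le> B * \<bar>F x - G x\<bar> + \<bar>prior x - a\<bar> * G x"
        using prior G0 by (intro add_mono mult_right_mono) auto
      finally show "ennreal \<bar>q x - a * G x\<bar> \<le> ennreal B * ennreal \<bar>F x - G x\<bar> + ennreal (\<bar>prior x - a\<bar> * G x)"
        using B G0 by (simp add: ennreal_leI flip: ennreal_mult ennreal_plus)
    qed
    also have "\<dots> = ennreal B * (\<integral>\<^sup>+x. ennreal \<bar>F x - G x\<bar> \<partial>lborel) + (\<integral>\<^sup>+x. ennreal (\<bar>prior x - a\<bar> * G x) \<partial>lborel)"
      by (subst nn_integral_add; (subst nn_integral_cmult)?) auto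
    also have "\<dots> \<le> ennreal B * ennreal (CARD('p) * (2 ^ CARD('p) * e)) + ennreal (\<tau> + B * (CARD('p) * e))"
      by (intro add_mono mult_left_mono FG priorG) auto
    also have "\<dots> = ennreal \<theta>"
      using B e by (simp add: \<theta>(1) flip: ennreal_mult ennreal_plus)
    finally show ?thesis .
  qed
  have \<theta>0: "0 \<le> \<theta>" using e B by (simp add: \<theta>(1))
  have a: "0 < a" using prior by (simp add: a_def)
  have iG: "integrable lborel G" and G1: "(\<integral>x. G x \<partial>lborel) = 1"
    using nn_integral_eq_integrable[of G lborel 1] Gint G0 by (auto simp: AE_I2)
  \<comment> \<open>Integrability of the unnormalised posterior \<open>q\<close> comes out of the
    estimate itself: \<open>q\<close> is at finite \<open>L1\<close> distance from the integrable
    \<open>a * G\<close>.\<close>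
  have id: "integrable lborel (\<lambda>x. q x - a * G x)"
    using main by (intro integrableI_bounded) (auto simp: le_less_trans[OF _ ennreal_less_top])
  have iq: "integrable lborel q"
    using Bochner_Integration.integrable_add[OF id integrable_mult_right[OF iG, of a]] by simp
  have d: "(\<integral>x. \<bar>q x - a * G x\<bar> \<partial>lborel) \<le> \<theta>"
    using main \<theta>0 id by (subst (asm) nn_integral_eq_integral) (auto simp: ennreal_le_iff)
  define c where "c = (\<integral>x. q x \<partial>lborel)"
  have "c - a = (\<integral>x. q x - a * G x \<partial>lborel)" using iq iG by (simp add: c_def G1)
  then have ca: "\<bar>c - a\<bar> \<le> \<theta>"
    using d integral_abs_bound[of lborel "\<lambda>x. q x - a * G x"] by linarith
  then have c: "a / 2 \<le> c" "0 < c" using \<theta>(2) a by (auto simp: a_def)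
  have wq: "w x / (\<integral>y. w y \<partial>lborel) = q x / c" for x
  proof -
    have "w = (\<lambda>x. K * q x)" using w by (auto simp: q_def F_def)
    then show ?thesis using w(1) by (simp add: c_def)
  qed
  have "tv_dist (density lborel (\<lambda>x. ennreal (q x / c))) (density lborel (\<lambda>x. ennreal (G x)))
      \<le> (\<integral>x. \<bar>q x / c - G x\<bar> \<partial>lborel)"
    using iq iG c G0 q0 by (intro tv_dist_density_le) auto
  \<comment> \<open>Replacing \<open>a\<close> by the true normaliser \<open>c\<close> costs a
    further \<open>\<bar>c - a\<bar>\<close>, again at most \<open>\<theta>\<close>; division by
    \<open>c \<ge> a / 2\<close> then produces the factor 4.\<close>
  also have "\<dots> \<le> (\<integral>x. (\<bar>q x - a * G x\<bar> + \<bar>c - a\<bar> * G x) / c \<partial>lborel)"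
  proof (rule integral_mono)
    fix x
    have "\<bar>q x / c - G x\<bar> = \<bar>q x - c * G x\<bar> / c" using c by (simp add: field_simps)
    also have "q x - c * G x = (q x - a * G x) + (a - c) * G x" by (simp add: algebra_simps)
    also have "\<bar>\<dots>\<bar> \<le> \<bar>q x - a * G x\<bar> + \<bar>c - a\<bar> * G x"
      using abs_triangle_ineq[of "q x - a * G x" "(a - c) * G x"] G0
      by (simp add: abs_mult abs_minus_commute)
    finally show "\<bar>q x / c - G x\<bar> \<le> (\<bar>q x - a * G x\<bar> + \<bar>c - a\<bar> * G x) / c"
      using c by (simp add: divide_right_mono)
  qed (use iq iG id in auto)
  also have "\<dots> = ((\<integral>x. \<bar>q x - a * G x\<bar> \<partial>lborel) + \<bar>c - a\<bar>) / c"
    using id iG by (simp add: G1)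
  also have "\<dots> \<le> (2 * \<theta>) / (a / 2)"
    using d ca c a \<theta>0 by (intro frac_le) auto
  finally show ?thesis unfolding wq by (simp add: G_def a_def)
qed

section \<open>Exponential families\<close>

text \<open>\<open>nondegenerate\<close> says that the measure with density \<open>h\<close> is not
  concentrated at any one point. It serves twice: the measure is nonzero, so the partition function
  is positive, and the variance of the family is positive.\<close>

locale exp_family =
  fixes h :: "real \<Rightarrow> real" and \<mu> :: "real measure"
  assumes base: "sets \<mu> = sets borel"
    and h_meas: "h \<in> borel_measurable \<mu>" and h_nonneg: "\<And>y. h y \<ge> 0"
    and nondegenerate: "\<And>c. \<not> (AE y in \<mu>. h y \<noteq> 0 \<longrightarrow> y = c)"
begin

abbreviation b :: "real \<Rightarrow> real" where "b \<equiv> lognorm h \<mu>"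
abbreviation D :: "real set" where "D \<equiv> natspace h \<mu>"

text \<open>With the weight absorbed, \<open>ef_partition h \<mu>\<close> is the moment generating
  function of \<open>\<nu>\<close>.\<close>

definition \<nu> :: "real measure" where "\<nu> = density \<mu> (\<lambda>y. ennreal (h y))"

lemma measurable_h[measurable]: "h \<in> borel_measurable borel"
  using h_meas measurable_cong_sets[OF base refl] by blast

lemma sets_\<nu>[measurable_cong, simp]: "sets \<nu> = sets borel" by (simp add: \<nu>_def base)

lemmas sets_base[measurable_cong] = base

lemma nn_integral_\<nu>:
  assumes [measurable]: "f \<in> borel_measurable borel"
  shows "(\<integral>\<^sup>+y. f y \<partial>\<nu>) = (\<integral>\<^sup>+y. f y * ennreal (h y) \<partial>\<mu>)"
  unfolding \<nu>_def by (subst nn_integral_density) (auto simp: mult.commute)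

lemma ef_partition_eq: "ef_partition h \<mu> \<eta> = (\<integral>\<^sup>+y. ennreal (exp (\<eta> * y)) \<partial>\<nu>)"
  by (simp add: ef_partition_def nn_integral_\<nu> ennreal_mult h_nonneg)

lemma AE_\<nu>: "(AE y in \<nu>. P y) \<longleftrightarrow> (AE y in \<mu>. h y \<noteq> 0 \<longrightarrow> P y)"
  unfolding \<nu>_def using h_nonneg
  by (subst AE_density) (auto simp: order_less_le)

lemma integrable_exp_iff: "\<eta> \<in> D \<longleftrightarrow> integrable \<nu> (\<lambda>y. exp (\<eta> * y))"
  by (simp add: natspace_def ef_partition_eq integrable_iff_bounded)

text \<open>Justifies inverting \<open>ln\<close> and \<open>enn2real\<close>: on \<open>D\<close>
  the partition function is finite by definition and positive by nondegeneracy.\<close>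

lemma exp_lognorm:
  assumes "\<eta> \<in> D"
  shows "exp (b \<eta>) = (\<integral>y. exp (\<eta> * y) \<partial>\<nu>)" "ef_partition h \<mu> \<eta> = ennreal (exp (b \<eta>))"
proof -
  have i: "integrable \<nu> (\<lambda>y. exp (\<eta> * y))" using assms by (simp add: integrable_exp_iff)
  have e: "ef_partition h \<mu> \<eta> = ennreal (\<integral>y. exp (\<eta> * y) \<partial>\<nu>)"
    unfolding ef_partition_eq by (rule nn_integral_eq_integral[OF i]) auto
  have "(\<integral>y. exp (\<eta> * y) \<partial>\<nu>) \<noteq> 0"
  proof
    assume "(\<integral>y. exp (\<eta> * y) \<partial>\<nu>) = 0"
    then have "AE y in \<nu>. exp (\<eta> * y) = 0"
      using integral_nonneg_eq_0_iff_AE[OF i] by simp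
    \<comment> \<open>An exponential never vanishes, so anything holds almost everywhere here;
      \<open>y = 0\<close> is picked to contradict \<open>nondegenerate\<close>.\<close>
    then have "AE y in \<nu>. y = 0" by eventually_elim simp
    then show False using nondegenerate[of 0] by (simp add: AE_\<nu>)
  qed
  moreover have "(\<integral>y. exp (\<eta> * y) \<partial>\<nu>) \<ge> 0" by (simp add: integral_nonneg_AE)
  ultimately have p: "(\<integral>y. exp (\<eta> * y) \<partial>\<nu>) > 0" by linarith
  then show "exp (b \<eta>) = (\<integral>y. exp (\<eta> * y) \<partial>\<nu>)" by (simp add: lognorm_def e)
  with e show "ef_partition h \<mu> \<eta> = ennreal (exp (b \<eta>))" by simp
qed

lemma nn_integral_exp_lognorm:
  assumes "\<eta> \<in> D"
  shows "(\<integral>\<^sup>+y. ennreal (exp (\<eta> * y - b \<eta>)) \<partial>\<nu>) = 1"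
proof -
  have "(\<integral>\<^sup>+y. ennreal (exp (\<eta> * y - b \<eta>)) \<partial>\<nu>) = (\<integral>\<^sup>+y. ennreal (exp (- b \<eta>)) * ennreal (exp (\<eta> * y)) \<partial>\<nu>)"
    by (intro nn_integral_cong) (simp add: flip: ennreal_mult exp_add)
  also have "\<dots> = ennreal (exp (- b \<eta>)) * ef_partition h \<mu> \<eta>"
    unfolding ef_partition_eq by (rule nn_integral_cmult) auto
  also have "\<dots> = 1" by (simp add: exp_lognorm(2)[OF assms] flip: ennreal_mult exp_add)
  finally show ?thesis .
qed

section \<open>Convexity and measurability of the log-partition function\<close>

lemma lognorm_le:
  assumes "ef_partition h \<mu> \<eta> \<le> ennreal (exp c)"
  shows "\<eta> \<in> D" "b \<eta> \<le> c"
proof -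
  show "\<eta> \<in> D" using assms by (auto simp: natspace_def intro: le_less_trans)
  from exp_lognorm(2)[OF this] assms show "b \<eta> \<le> c" by simp
qed

text \<open>This is Hoelder's inequality, obtained from pointwise convexity of \<open>exp\<close>
  applied to the two normalised densities, each of integral 1. The bound on the partition function
  yields convexity of \<open>D\<close> and of \<open>b\<close> at once.\<close>

lemma convex_lognorm: "convex_on D b"
proof -
  have *: "ef_partition h \<mu> ((1 - t) * x + t * y) \<le> ennreal (exp ((1 - t) * b x + t * b y))"
    if xy: "x \<in> D" "y \<in> D" and t: "0 \<le> t" "t \<le> 1" for x y t
  proof -
    let ?c = "(1 - t) * b x + t * b y"
    let ?e = "\<lambda>\<eta> z. exp (\<eta> * z - b \<eta>)"
    have "ef_partition h \<mu> ((1 - t) * x + t * y)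
        \<le> (\<integral>\<^sup>+z. ennreal (exp ?c) * (ennreal (1 - t) * ennreal (?e x z) + ennreal t * ennreal (?e y z)) \<partial>\<nu>)"
      unfolding ef_partition_eq
    proof (rule nn_integral_mono)
      fix z
      have "exp (((1 - t) * x + t * y) * z) = exp ?c * exp ((1 - t) *\<^sub>R (x * z - b x) + t *\<^sub>R (y * z - b y))"
        by (simp add: algebra_simps flip: exp_add)
      also have "\<dots> \<le> exp ?c * ((1 - t) * ?e x z + t * ?e y z)"
        using t by (intro mult_left_mono convex_onD[OF exp_convex]) auto
      finally show "ennreal (exp (((1 - t) * x + t * y) * z))
          \<le> ennreal (exp ?c) * (ennreal (1 - t) * ennreal (?e x z) + ennreal t * ennreal (?e y z))"
        using t by (simp add: ennreal_leI flip: ennreal_mult ennreal_plus)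
    qed
    also have "\<dots> = ennreal (exp ?c) * (ennreal (1 - t) * (\<integral>\<^sup>+z. ?e x z \<partial>\<nu>) + ennreal t * (\<integral>\<^sup>+z. ?e y z \<partial>\<nu>))"
      by (subst nn_integral_cmult; (subst nn_integral_add)?; (subst nn_integral_cmult)?; (subst nn_integral_cmult)?) auto
    also have "\<dots> = ennreal (exp ?c)"
      using t xy by (simp add: nn_integral_exp_lognorm flip: ennreal_plus)
    finally show ?thesis .
  qed
  show ?thesis
  proof (rule convex_onI)
    show "convex D" unfolding convex_alt using *[THEN lognorm_le(1)] by auto
    show "b ((1 - t) *\<^sub>R x + t *\<^sub>R y) \<le> (1 - t) * b x + t * b y"
      if "0 < t" "t < 1" "x \<in> D" "y \<in> D" for t x y
      using *[THEN lognorm_le(2), of x y t] that by simp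
  qed
qed

text \<open>Tilting \<open>\<nu>\<close> by \<open>exp (\<eta>0 * y)\<close> makes it finite, and
  the partition function becomes a parameter integral against this finite measure, hence measurable
  in the parameter.\<close>

lemma measurable_natspace_lognorm:
  assumes "\<eta>0 \<in> D"
  shows "D \<in> sets borel" "b \<in> borel_measurable borel"
proof -
  define \<nu>0 where "\<nu>0 = density \<nu> (\<lambda>y. ennreal (exp (\<eta>0 * y)))"
  have [measurable_cong]: "sets \<nu>0 = sets borel" by (simp add: \<nu>0_def)
  interpret finite_measure \<nu>0
  proof
    have "emeasure \<nu>0 (space \<nu>0) = ef_partition h \<mu> \<eta>0"
      unfolding ef_partition_eq \<nu>0_def space_density
      by (subst emeasure_density[OF _ sets.top]) (auto intro!: nn_integral_cong simp: indicator_def)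
    then show "emeasure \<nu>0 (space \<nu>0) \<noteq> \<infinity>"
      using assms by (simp add: natspace_def)
  qed
  have "ef_partition h \<mu> \<eta> = (\<integral>\<^sup>+y. ennreal (exp ((\<eta> - \<eta>0) * y)) \<partial>\<nu>0)" for \<eta>
    unfolding ef_partition_eq \<nu>0_def
    by (subst nn_integral_density) (auto simp: algebra_simps simp flip: ennreal_mult exp_add)
  then have [measurable]: "ef_partition h \<mu> \<in> borel_measurable borel"
    by (subst measurable_cong) auto
  show "D \<in> sets borel" unfolding natspace_def by measurable
  show "b \<in> borel_measurable borel" unfolding lognorm_def[abs_def] by measurable
qed

text \<open>The exponential series is integrated term by term. All partial sums are dominated by the
  sum of the exponentials at the endpoints \<open>\<eta>0 + s\<close> and
  \<open>\<eta>0 - s\<close>, which are integrable because both endpoints lie in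
  \<open>D\<close>.\<close>

lemma partition_power_series:
  assumes s: "0 < s" "\<And>x. \<bar>x\<bar> \<le> s \<Longrightarrow> \<eta>0 + x \<in> D"
  shows "integrable \<nu> (\<lambda>y. y ^ k * exp (\<eta>0 * y))"
    and "\<bar>x\<bar> \<le> s \<Longrightarrow> (\<lambda>k. (\<integral>y. y ^ k * exp (\<eta>0 * y) \<partial>\<nu>) / fact k * x ^ k) sums exp (b (\<eta>0 + x))"
proof -
  have dom: "integrable \<nu> (\<lambda>y. exp ((\<eta>0 + s) * y) + exp ((\<eta>0 - s) * y))"
    using s(2)[of s] s(2)[of "-s"] s(1) by (simp add: integrable_exp_iff)
  have le_dom: "exp (\<bar>x\<bar> * \<bar>y\<bar>) * exp (\<eta>0 * y) \<le> exp ((\<eta>0 + s) * y) + exp ((\<eta>0 - s) * y)"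
    if "\<bar>x\<bar> \<le> s" for x y
  proof -
    have "exp (\<bar>x\<bar> * \<bar>y\<bar>) * exp (\<eta>0 * y) \<le> exp (s * \<bar>y\<bar>) * exp (\<eta>0 * y)"
      using that by (simp add: mult_right_mono)
    also have "\<dots> \<le> exp ((\<eta>0 + s) * y) + exp ((\<eta>0 - s) * y)"
      by (cases "0 \<le> y") (auto simp: abs_if algebra_simps simp flip: exp_add intro: add_increasing add_increasing2)
    finally show ?thesis .
  qed
  have exp_ge: "(\<Sum>k<n. z ^ k / fact k) \<le> exp z" if "0 \<le> z" for z :: real and n
    using sum_le_suminf[OF summable_exp[of z], of "{..<n}"] that
    by (simp add: exp_def divide_inverse mult.commute)
  have pow_le: "z ^ k / fact k \<le> exp z" if "0 \<le> z" for z :: real and k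
    using exp_ge[OF that, of "Suc k"] that sum_nonneg[of "{..<k}" "\<lambda>k. z ^ k / fact k"] by auto
  show int: "integrable \<nu> (\<lambda>y. y ^ k * exp (\<eta>0 * y))" for k
  proof (rule Bochner_Integration.integrable_bound)
    show "integrable \<nu> (\<lambda>y. fact k / s ^ k * (exp ((\<eta>0 + s) * y) + exp ((\<eta>0 - s) * y)))"
      using dom by (rule integrable_mult_right)
    show "AE y in \<nu>. norm (y ^ k * exp (\<eta>0 * y)) \<le> norm (fact k / s ^ k * (exp ((\<eta>0 + s) * y) + exp ((\<eta>0 - s) * y)))"
    proof (rule AE_I2)
      fix y
      \<comment> \<open>One term of the exponential series at \<open>s * \<bar>y\<bar>\<close> is
        below the full sum; this controls every moment.\<close>
      have "\<bar>y\<bar> ^ k * (s ^ k / fact k) = (s * \<bar>y\<bar>) ^ k / fact k" by (simp add: power_mult_distrib)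
      also have "\<dots> \<le> exp (s * \<bar>y\<bar>)" using s by (intro pow_le) auto
      finally have "\<bar>y\<bar> ^ k \<le> fact k / s ^ k * exp (s * \<bar>y\<bar>)"
        using s by (simp add: field_simps)
      then have "\<bar>y\<bar> ^ k * exp (\<eta>0 * y) \<le> fact k / s ^ k * exp (s * \<bar>y\<bar>) * exp (\<eta>0 * y)"
        by (intro mult_right_mono) auto
      also have "\<dots> \<le> fact k / s ^ k * (exp ((\<eta>0 + s) * y) + exp ((\<eta>0 - s) * y))"
        unfolding mult.assoc using le_dom[of s y] s by (intro mult_left_mono) auto
      finally have *: "norm (y ^ k * exp (\<eta>0 * y)) \<le> fact k / s ^ k * (exp ((\<eta>0 + s) * y) + exp ((\<eta>0 - s) * y))"
        by (simp add: abs_mult power_abs)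
      then show "norm (y ^ k * exp (\<eta>0 * y)) \<le> norm (fact k / s ^ k * (exp ((\<eta>0 + s) * y) + exp ((\<eta>0 - s) * y)))"
        by (rule order_trans) (simp only: real_norm_def abs_ge_self)
    qed
  qed measurable
  assume x: "\<bar>x\<bar> \<le> s"
  have "(\<lambda>n. \<integral>y. (\<Sum>k<n. (x * y) ^ k / fact k) * exp (\<eta>0 * y) \<partial>\<nu>)
      \<longlonglongrightarrow> (\<integral>y. exp (x * y) * exp (\<eta>0 * y) \<partial>\<nu>)"
  proof (rule integral_dominated_convergence[OF _ _ dom])
    show "AE y in \<nu>. (\<lambda>n. (\<Sum>k<n. (x * y) ^ k / fact k) * exp (\<eta>0 * y)) \<longlonglongrightarrow> exp (x * y) * exp (\<eta>0 * y)"
    proof (intro AE_I2 tendsto_mult_right)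
      fix y
      show "(\<lambda>n. \<Sum>k<n. (x * y) ^ k / fact k) \<longlonglongrightarrow> exp (x * y)"
        using exp_converges[of "x * y"] by (simp add: sums_def divide_inverse mult.commute)
    qed
    show "AE y in \<nu>. norm ((\<Sum>k<n. (x * y) ^ k / fact k) * exp (\<eta>0 * y)) \<le> exp ((\<eta>0 + s) * y) + exp ((\<eta>0 - s) * y)" for n
    proof (rule AE_I2)
      fix y
      have "\<bar>\<Sum>k<n. (x * y) ^ k / fact k\<bar> \<le> (\<Sum>k<n. \<bar>x * y\<bar> ^ k / fact k)"
        by (rule order_trans[OF sum_abs]) (simp add: power_abs)
      also have "\<dots> \<le> exp (\<bar>x\<bar> * \<bar>y\<bar>)" using exp_ge[of "\<bar>x * y\<bar>" n] by (simp add: abs_mult)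
      finally have "\<bar>\<Sum>k<n. (x * y) ^ k / fact k\<bar> * exp (\<eta>0 * y) \<le> exp (\<bar>x\<bar> * \<bar>y\<bar>) * exp (\<eta>0 * y)"
        by (simp add: mult_right_mono)
      also note le_dom[OF x]
      finally show "norm ((\<Sum>k<n. (x * y) ^ k / fact k) * exp (\<eta>0 * y)) \<le> exp ((\<eta>0 + s) * y) + exp ((\<eta>0 - s) * y)"
        by (simp add: abs_mult)
    qed
  qed measurable
  moreover have "(\<integral>y. (\<Sum>k<n. (x * y) ^ k / fact k) * exp (\<eta>0 * y) \<partial>\<nu>)
      = (\<Sum>k<n. (\<integral>y. y ^ k * exp (\<eta>0 * y) \<partial>\<nu>) / fact k * x ^ k)" for n
  proof -
    have "(\<integral>y. (\<Sum>k<n. (x * y) ^ k / fact k) * exp (\<eta>0 * y) \<partial>\<nu>)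
        = (\<integral>y. (\<Sum>k<n. x ^ k / fact k * (y ^ k * exp (\<eta>0 * y))) \<partial>\<nu>)"
      by (intro Bochner_Integration.integral_cong) (auto simp: sum_distrib_right power_mult_distrib intro!: sum.cong)
    also have "\<dots> = (\<Sum>k<n. x ^ k / fact k * (\<integral>y. y ^ k * exp (\<eta>0 * y) \<partial>\<nu>))"
      by (subst Bochner_Integration.integral_sum, intro integrable_mult_right int)
         (simp only: integral_mult_right_zero)
    finally show ?thesis by (simp add: mult.commute)
  qed
  moreover have "(\<integral>y. exp (x * y) * exp (\<eta>0 * y) \<partial>\<nu>) = exp (b (\<eta>0 + x))"
    using exp_lognorm(1)[OF s(2)[OF x]] by (simp add: algebra_simps flip: exp_add)
  ultimately show "(\<lambda>k. (\<integral>y. y ^ k * exp (\<eta>0 * y) \<partial>\<nu>) / fact k * x ^ k) sums exp (b (\<eta>0 + x))"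
    by (simp add: sums_def)
qed

text \<open>Near \<open>\<eta>0\<close>, \<open>b\<close> is the logarithm of a positive power
  series, so Taylor's theorem applies with a locally bounded third derivative. \<open>v\<close> is
  the variance of the family at \<open>\<eta>0\<close>, hence positive.\<close>

lemma lognorm_expansion:
  assumes int: "\<eta>0 \<in> interior D"
  defines "v \<equiv> deriv (deriv b) \<eta>0"
  obtains C r where "0 < v" "0 < C" "0 < r"
    "\<And>x. \<bar>x\<bar> \<le> r \<Longrightarrow> \<eta>0 + x \<in> D \<and>
      \<bar>b (\<eta>0 + x) - b \<eta>0 - deriv b \<eta>0 * x - v * x\<^sup>2 / 2\<bar> \<le> C * \<bar>x\<bar> ^ 3"
proof -
  obtain s where s: "0 < s" "cball \<eta>0 s \<subseteq> D" using int by (auto simp: mem_interior_cball)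
  have sD: "\<eta>0 + x \<in> D" if "\<bar>x\<bar> \<le> s" for x
    using s(2) that by (auto simp: dist_real_def subset_eq)
  define m where "m = (\<lambda>k. \<integral>y. y ^ k * exp (\<eta>0 * y) \<partial>\<nu>)"
  define a where "a = (\<lambda>k. m k / fact k)"
  have im: "integrable \<nu> (\<lambda>y. y ^ k * exp (\<eta>0 * y))" for k
    by (rule partition_power_series(1)[OF s(1) sD])
  have sums: "(\<lambda>k. a k * x ^ k) sums exp (b (\<eta>0 + x))" if "\<bar>x\<bar> \<le> s" for x
    using partition_power_series(2)[OF s(1) sD that] by (simp add: a_def m_def)
  \<comment> \<open>\<open>Q j\<close> is the \<open>j\<close>-th termwise derivative of the series,
    and \<open>Q 0 x\<close> is \<open>exp (b (\<eta>0 + x))\<close>.\<close>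
  define Q where "Q = (\<lambda>j x. \<Sum>n. (diffs ^^ j) a n * x ^ n)"
  have summ: "summable (\<lambda>n. (diffs ^^ j) a n * x ^ n)" if "\<bar>x\<bar> < s" for j x
    using that
  proof (induction j arbitrary: x)
    case 0
    then show ?case using sums[of x] by (simp add: sums_iff)
  next
    case (Suc j)
    show ?case using termdiff_converges[of x s "(diffs ^^ j) a"] Suc by auto
  qed
  have dQ: "(Q j has_real_derivative Q (Suc j) x) (at x)" if "\<bar>x\<bar> < s" for j x
    using termdiffs_strong'[of s "(diffs ^^ j) a" x] summ that by (simp add: Q_def)
  have Q0: "Q 0 x = exp (b (\<eta>0 + x))" if "\<bar>x\<bar> \<le> s" for x
    using sums[OF that] by (simp add: Q_def sums_iff)
  have Q0p: "0 < Q 0 x" if "\<bar>x\<bar> < s" for x using that by (simp add: Q0)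
  \<comment> \<open>\<open>B1\<close>, \<open>B2\<close>, \<open>B3\<close> are the first three
    derivatives of \<open>ln (Q 0 x)\<close>; \<open>B3\<close> keeps the shape given by the
    quotient rule.\<close>
  define B1 where "B1 = (\<lambda>x. Q 1 x / Q 0 x)"
  define B2 where "B2 = (\<lambda>x. Q 2 x / Q 0 x - (Q 1 x / Q 0 x)\<^sup>2)"
  define B3 where "B3 = (\<lambda>x. (Q 3 x * Q 0 x - Q 2 x * Q 1 x) / (Q 0 x * Q 0 x)
      - 2 * (Q 1 x / Q 0 x) * ((Q 2 x * Q 0 x - Q 1 x * Q 1 x) / (Q 0 x * Q 0 x)))"
  have d0: "((\<lambda>x. b (\<eta>0 + x)) has_real_derivative B1 x) (at x)" if x: "\<bar>x\<bar> < s" for x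
  proof (rule has_field_derivative_transform_within_open[where S = "ball 0 s" and f = "\<lambda>x. ln (Q 0 x)"])
    show "((\<lambda>x. ln (Q 0 x)) has_real_derivative B1 x) (at x)"
      using dQ[OF x, of 0] Q0p[OF x]
      by (auto intro!: derivative_eq_intros simp: B1_def)
  qed (use x in \<open>auto simp: Q0\<close>)
  have d1: "(B1 has_real_derivative B2 x) (at x)" if x: "\<bar>x\<bar> < s" for x
    unfolding B1_def using dQ[OF x, of 0] dQ[OF x, of 1] Q0p[OF x]
    by (auto intro!: derivative_eq_intros simp: B2_def power2_eq_square field_simps numeral_2_eq_2)
  have d2: "(B2 has_real_derivative B3 x) (at x)" if x: "\<bar>x\<bar> < s" for x
    unfolding B2_def using dQ[OF x, of 0] dQ[OF x, of 1] dQ[OF x, of 2] Q0p[OF x]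
    by (auto intro!: derivative_eq_intros simp: B3_def numeral_2_eq_2 numeral_3_eq_3 field_simps)
  have db: "(b has_real_derivative B1 (\<eta> - \<eta>0)) (at \<eta>)" if "\<bar>\<eta> - \<eta>0\<bar> < s" for \<eta>
    using DERIV_shift[of "\<lambda>x. b (\<eta>0 + x)" "B1 (\<eta> - \<eta>0)" \<eta> "- \<eta>0"] d0[OF that] by simp
  have deriv_b: "deriv b \<eta> = B1 (\<eta> - \<eta>0)" if "\<bar>\<eta> - \<eta>0\<bar> < s" for \<eta>
    using db[OF that] by (rule DERIV_imp_deriv)
  \<comment> \<open>The outer derivative sees \<open>deriv b\<close> on a neighbourhood, so its
    identification with \<open>B1\<close> is used on a whole ball.\<close>
  have v: "v = B2 0"
    unfolding v_def
  proof (rule DERIV_imp_deriv, rule has_field_derivative_transform_within_open[where S = "ball \<eta>0 s" and f = "\<lambda>\<eta>. B1 (\<eta> - \<eta>0)"])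
    show "((\<lambda>\<eta>. B1 (\<eta> - \<eta>0)) has_real_derivative B2 0) (at \<eta>0)"
      using DERIV_shift[of B1 "B2 0" \<eta>0 "- \<eta>0"] d1[of 0] s by simp
  qed (use s in \<open>auto simp: deriv_b dist_real_def abs_minus_commute\<close>)
  \<comment> \<open>Halving the radius gives a compact interval inside the open interval of
    differentiability.\<close>
  have "continuous_on {-(s/2)..s/2} B3"
  proof -
    have "continuous_on {-(s/2)..s/2} (Q j)" for j
      by (intro continuous_at_imp_continuous_on ballI DERIV_isCont[OF dQ]) (use s in auto)
    moreover have "Q 0 x \<noteq> 0" if "x \<in> {-(s/2)..s/2}" for x
    proof -
      have "\<bar>x\<bar> < s" using that s by auto
      then show ?thesis using Q0p[of x] by simp
    qed
    ultimately show ?thesis unfolding B3_def by (intro continuous_intros) auto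
  qed
  then have "bounded (B3 ` {-(s/2)..s/2})"
    by (intro compact_imp_bounded compact_continuous_image) auto
  then obtain C where C: "0 < C" "\<And>x. x \<in> {-(s/2)..s/2} \<Longrightarrow> \<bar>B3 x\<bar> \<le> C"
    unfolding bounded_pos by auto
  have vpos: "0 < v"
  proof -
    have m0: "Q 0 0 = m 0" "Q 1 0 = m 1" "Q 2 0 = m 2"
      unfolding Q_def powser_zero by (simp_all add: a_def diffs_def numeral_2_eq_2)
    have m0p: "0 < m 0" using Q0p[of 0] s m0 by simp
    \<comment> \<open>\<open>c\<close> is the mean of the tilted law. The second moment about it,
      \<open>v * m 0\<close>, could vanish only if \<open>\<nu>\<close> were concentrated at
      \<open>c\<close>.\<close>
    define c where "c = m 1 / m 0"
    have e: "(\<lambda>y. (y - c)\<^sup>2 * exp (\<eta>0 * y))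
      = (\<lambda>y. y ^ 2 * exp (\<eta>0 * y) + (- 2 * c) * (y ^ 1 * exp (\<eta>0 * y)) + c\<^sup>2 * (y ^ 0 * exp (\<eta>0 * y)))"
      by (auto simp: power2_eq_square algebra_simps)
    have i: "integrable \<nu> (\<lambda>y. (y - c)\<^sup>2 * exp (\<eta>0 * y))"
      unfolding e by (intro Bochner_Integration.integrable_add integrable_mult_right im)
    have "(\<integral>y. (y - c)\<^sup>2 * exp (\<eta>0 * y) \<partial>\<nu>) = m 2 + (- 2 * c) * m 1 + c\<^sup>2 * m 0"
      unfolding e m_def
      by (subst Bochner_Integration.integral_add Bochner_Integration.integral_mult_right_zero;
          (intro Bochner_Integration.integrable_add integrable_mult_right im)?)+ simp
    also have "\<dots> = v * m 0"
      unfolding v B2_def m0 c_def using m0p by (simp add: power2_eq_square field_simps)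
    finally have E: "(\<integral>y. (y - c)\<^sup>2 * exp (\<eta>0 * y) \<partial>\<nu>) = v * m 0" .
    have "(\<integral>y. (y - c)\<^sup>2 * exp (\<eta>0 * y) \<partial>\<nu>) \<noteq> 0"
    proof
      assume "(\<integral>y. (y - c)\<^sup>2 * exp (\<eta>0 * y) \<partial>\<nu>) = 0"
      then have "AE y in \<nu>. (y - c)\<^sup>2 * exp (\<eta>0 * y) = 0"
        using integral_nonneg_eq_0_iff_AE[OF i] by simp
      then have "AE y in \<nu>. y = c" by simp
      then show False using nondegenerate[of c] by (simp add: AE_\<nu>)
    qed
    moreover have "(\<integral>y. (y - c)\<^sup>2 * exp (\<eta>0 * y) \<partial>\<nu>) \<ge> 0" by (simp add: integral_nonneg_AE)
    ultimately show ?thesis using E m0p by (metis order_less_le zero_less_mult_pos2)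
  qed
  show thesis
  proof (rule that[OF vpos C(1)])
    show "0 < s / 2" using s by simp
    fix x :: real assume x: "\<bar>x\<bar> \<le> s / 2"
    define diff where "diff = (\<lambda>j::nat. if j = 0 then (\<lambda>x. b (\<eta>0 + x)) else if j = 1 then B1 else if j = 2 then B2 else B3)"
    have "\<exists>t. \<bar>t\<bar> \<le> \<bar>x\<bar> \<and> b (\<eta>0 + x) = (\<Sum>j<3. diff j 0 / fact j * x ^ j) + diff 3 t / fact 3 * x ^ 3"
    proof (rule Maclaurin_bi_le)
      show "diff 0 = (\<lambda>x. b (\<eta>0 + x))" by (simp add: diff_def)
      have "DERIV (diff j) t :> diff (Suc j) t" if "j < 3" "\<bar>t\<bar> \<le> \<bar>x\<bar>" for j t
      proof -
        have t: "\<bar>t\<bar> < s" using that x s by linarith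
        have "j = 0 \<or> j = 1 \<or> j = 2" using that by auto
        then show ?thesis using d0[OF t] d1[OF t] d2[OF t] by (auto simp: diff_def)
      qed
      then show "\<forall>j t. j < 3 \<and> \<bar>t\<bar> \<le> \<bar>x\<bar> \<longrightarrow> DERIV (diff j) t :> diff (Suc j) t" by blast
    qed
    then obtain t where t: "\<bar>t\<bar> \<le> \<bar>x\<bar>"
      "b (\<eta>0 + x) = (\<Sum>j<3. diff j 0 / fact j * x ^ j) + diff 3 t / fact 3 * x ^ 3" by blast
    have "deriv b \<eta>0 = B1 0" using deriv_b[of \<eta>0] s by simp
    then have "b (\<eta>0 + x) - b \<eta>0 - deriv b \<eta>0 * x - v * x\<^sup>2 / 2 = B3 t / 6 * x ^ 3"
      using t(2) by (simp add: diff_def v eval_nat_numeral)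
    moreover have "t \<in> {-(s/2)..s/2}" using t(1) x by auto
    then have "\<bar>B3 t / 6 * x ^ 3\<bar> \<le> C * \<bar>x\<bar> ^ 3"
      unfolding abs_mult power_abs using C(2)[of t] C(1) by (intro mult_right_mono) auto
    ultimately show "\<eta>0 + x \<in> D \<and> \<bar>b (\<eta>0 + x) - b \<eta>0 - deriv b \<eta>0 * x - v * x\<^sup>2 / 2\<bar> \<le> C * \<bar>x\<bar> ^ 3"
      using sD[of x] x s by simp
  qed
qed

end

section \<open>The law of the bandit history\<close>

text \<open>Other arms contribute zero terms, so the recursion in \<open>n\<close> and measurability
  can be checked term by term.\<close>

definition ysum :: "nat \<Rightarrow> (nat \<Rightarrow> 'p \<times> real) \<Rightarrow> 'p \<Rightarrow> real" where
  "ysum n \<omega> i = (\<Sum>j<n. if fst (\<omega> j) = i then snd (\<omega> j) else 0)"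

lemma num_pulls_eq_sum: "num_pulls n \<omega> i = (\<Sum>j<n. if fst (\<omega> j) = i then 1 else 0)"
proof -
  have "{j. j < n \<and> fst (\<omega> j) = i} = {j\<in>{..<n}. fst (\<omega> j) = i}" by auto
  then show ?thesis unfolding num_pulls_def by (simp add: sum.If_cases Int_def)
qed

lemma ybar_eq: "ybar n \<omega> i = ysum n \<omega> i / real (num_pulls n \<omega> i)"
proof -
  have "{j. j < n \<and> fst (\<omega> j) = i} = {j\<in>{..<n}. fst (\<omega> j) = i}" by auto
  then show ?thesis unfolding ybar_def ysum_def by (simp only: sum.inter_filter finite_lessThan)
qed

lemma num_pulls_upd:
  "num_pulls (Suc n) (fun_upd \<omega> n (k, y)) i = num_pulls n \<omega> i + (if k = i then 1 else 0)"
  by (simp add: num_pulls_eq_sum)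

lemma ysum_upd: "ysum (Suc n) (fun_upd \<omega> n (k, y)) i = ysum n \<omega> i + (if k = i then y else 0)"
  by (auto simp: ysum_def intro!: sum.cong)

lemma num_pulls_le: "num_pulls n \<omega> i \<le> n"
  unfolding num_pulls_eq_sum using sum_bounded_above[of "{..<n}" "\<lambda>j. if fst (\<omega> j) = i then 1 else 0" "1::nat"] by auto

text \<open>The exponent is regrouped by arm. The history enters only through the pull counts and
  reward sums, which reduces the likelihood to one-dimensional factors.\<close>

lemma likelihood_eq:
  fixes \<beta> :: "real ^ 'p"
  shows "likelihood h \<mu> n \<omega> \<beta>
    = (\<Prod>i\<in>UNIV. exp (\<beta> $ i * ysum n \<omega> i - real (num_pulls n \<omega> i) * lognorm h \<mu> (\<beta> $ i)))"
proof -
  let ?l = "lognorm h \<mu>"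
  have "(\<Sum>j<n. \<beta> $ fst (\<omega> j) * snd (\<omega> j) - ?l (\<beta> $ fst (\<omega> j)))
      = (\<Sum>j<n. \<Sum>i\<in>UNIV. if fst (\<omega> j) = i then \<beta> $ i * snd (\<omega> j) - ?l (\<beta> $ i) else 0)"
    by (simp add: sum.delta')
  also have "\<dots> = (\<Sum>i\<in>UNIV. \<Sum>j<n. if fst (\<omega> j) = i then \<beta> $ i * snd (\<omega> j) - ?l (\<beta> $ i) else 0)"
    by (rule sum.swap)
  also have "\<dots> = (\<Sum>i\<in>UNIV. \<beta> $ i * ysum n \<omega> i - real (num_pulls n \<omega> i) * ?l (\<beta> $ i))"
    unfolding ysum_def num_pulls_eq_sum of_nat_sum sum_distrib_left sum_distrib_right sum_subtractf[symmetric]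
    by (intro sum.cong refl) simp
  finally show ?thesis by (simp add: likelihood_def flip: exp_sum)
qed

locale bandit = exp_family h \<mu> for h :: "real \<Rightarrow> real" and \<mu> :: "real measure" +
  fixes \<beta>0 :: "real ^ 'p" and \<Lambda> :: "('p \<times> real) list \<Rightarrow> 'p pmf"
  assumes \<Lambda>_meas: "\<And>n i. (\<lambda>\<omega>. pmf (\<Lambda> (map \<omega> [0..<n])) i)
                        \<in> borel_measurable (PiM {..<n} (\<lambda>_. obs_space \<mu>))"
    and interior: "\<And>i. \<beta>0 $ i \<in> interior (natspace h \<mu>)"
begin

abbreviation "P n \<equiv> PiM {..<n} (\<lambda>_. obs_space \<mu> :: ('p \<times> real) measure)"
abbreviation "hist \<equiv> bandit_hist h \<mu> \<beta>0 \<Lambda>"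

definition arm :: "'p \<Rightarrow> real measure" where
  "arm i = density \<mu> (\<lambda>y. ennreal (exp (\<beta>0 $ i * y - b (\<beta>0 $ i)) * h y))"

lemma \<beta>0_natspace: "\<beta>0 $ i \<in> D"
  using interior interior_subset by blast

lemma sets_arm[measurable_cong, simp]: "sets (arm i) = sets borel"
  by (simp add: arm_def base)

lemma nn_integral_arm:
  assumes [measurable]: "f \<in> borel_measurable borel"
  shows "(\<integral>\<^sup>+y. f y \<partial>arm i) = (\<integral>\<^sup>+y. f y * ennreal (exp (\<beta>0 $ i * y - b (\<beta>0 $ i))) \<partial>\<nu>)"
  unfolding arm_def
  by (subst nn_integral_density)
     (auto simp: nn_integral_\<nu> h_nonneg ennreal_mult ac_simps intro!: nn_integral_cong)

lemma prob_space_arm: "prob_space (arm i)"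
proof
  have "emeasure (arm i) (space (arm i)) = (\<integral>\<^sup>+y. 1 \<partial>arm i)" by simp
  also have "\<dots> = 1"
    using nn_integral_exp_lognorm[OF \<beta>0_natspace] by (subst nn_integral_arm) auto
  finally show "emeasure (arm i) (space (arm i)) = 1" .
qed

section \<open>Transition kernels and the one-step recursion of the history law\<close>

lemma measurable_Pair_obs[measurable]: "(\<lambda>y. (i, y)) \<in> arm i \<rightarrow>\<^sub>M obs_space \<mu>"
proof -
  have "(\<lambda>y. (i, y)) \<in> \<mu> \<rightarrow>\<^sub>M obs_space \<mu>"
    unfolding obs_space_def by (rule measurable_Pair1') simp
  then show ?thesis using measurable_cong_sets[of "arm i" \<mu>] base by simp
qed

lemma arm_obs_kernel:
  "(\<lambda>i. distr (arm i) (obs_space \<mu>) (\<lambda>y. (i, y))) \<in> count_space UNIV \<rightarrow>\<^sub>M subprob_algebra (obs_space \<mu>)"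
proof -
  have "prob_space (distr (arm i) (obs_space \<mu>) (\<lambda>y. (i, y)))" for i
    by (intro prob_space.prob_space_distr prob_space_arm measurable_Pair_obs)
  then show ?thesis by (auto simp: space_subprob_algebra prob_space_imp_subprob_space)
qed

lemma bandit_step_eq:
  "bandit_step h \<mu> \<beta>0 \<Lambda> H = measure_pmf (\<Lambda> H) \<bind> (\<lambda>i. distr (arm i) (obs_space \<mu>) (\<lambda>y. (i, y)))"
  by (simp add: bandit_step_def arm_def)

text \<open>There are finitely many arms, so measurability of the kernel reduces to that of the
  point masses.\<close>

lemma rule_kernel:
  "(\<lambda>\<omega>. measure_pmf (\<Lambda> (map \<omega> [0..<n]))) \<in> P n \<rightarrow>\<^sub>M subprob_algebra (count_space UNIV)"
proof (rule measurable_subprob_algebra)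
  show "(\<lambda>\<omega>. emeasure (measure_pmf (\<Lambda> (map \<omega> [0..<n]))) A) \<in> borel_measurable (P n)" for A
    using \<Lambda>_meas by (simp add: emeasure_measure_pmf_finite)
qed (auto simp: measure_pmf.subprob_space_axioms)

lemma bandit_step_kernel:
  "(\<lambda>\<omega>. bandit_step h \<mu> \<beta>0 \<Lambda> (map \<omega> [0..<n])) \<in> P n \<rightarrow>\<^sub>M subprob_algebra (obs_space \<mu>)"
  unfolding bandit_step_eq by (rule measurable_bind2[OF rule_kernel arm_obs_kernel])

lemma prob_space_bandit_step: "prob_space (bandit_step h \<mu> \<beta>0 \<Lambda> H)"
  unfolding bandit_step_eq
proof (rule measure_pmf.prob_space_bind)
  show "AE i in measure_pmf (\<Lambda> H). prob_space (distr (arm i) (obs_space \<mu>) (\<lambda>y. (i, y)))"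
    by (intro AE_I2 prob_space.prob_space_distr prob_space_arm measurable_Pair_obs)
qed (use arm_obs_kernel in simp)

lemma nn_integral_bandit_step:
  assumes f: "f \<in> borel_measurable (obs_space \<mu>)"
  shows "(\<integral>\<^sup>+z. f z \<partial>bandit_step h \<mu> \<beta>0 \<Lambda> H)
    = (\<Sum>i\<in>UNIV. ennreal (pmf (\<Lambda> H) i) * (\<integral>\<^sup>+y. f (i, y) \<partial>arm i))"
proof -
  have "(\<integral>\<^sup>+z. f z \<partial>bandit_step h \<mu> \<beta>0 \<Lambda> H)
      = (\<integral>\<^sup>+i. \<integral>\<^sup>+z. f z \<partial>distr (arm i) (obs_space \<mu>) (\<lambda>y. (i, y)) \<partial>measure_pmf (\<Lambda> H))"
    unfolding bandit_step_eq by (rule nn_integral_bind[OF f]) (use arm_obs_kernel in simp)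
  also have "\<dots> = (\<integral>\<^sup>+i. \<integral>\<^sup>+y. f (i, y) \<partial>arm i \<partial>measure_pmf (\<Lambda> H))"
    by (subst nn_integral_distr[OF measurable_Pair_obs]) (simp_all add: f)
  also have "\<dots> = (\<Sum>i\<in>UNIV. ennreal (pmf (\<Lambda> H) i) * (\<integral>\<^sup>+y. f (i, y) \<partial>arm i))"
    by (simp add: nn_integral_measure_pmf nn_integral_count_space_finite)
  finally show ?thesis .
qed

lemma measurable_upd: "(\<lambda>(\<omega>, z). fun_upd \<omega> n z) \<in> P n \<Otimes>\<^sub>M obs_space \<mu> \<rightarrow>\<^sub>M P (Suc n)"
  using measurable_add_dim[of n "{..<n}" "\<lambda>_. obs_space \<mu>"] by (simp add: lessThan_Suc)

lemma hist_kernel: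
  "(\<lambda>\<omega>. distr (bandit_step h \<mu> \<beta>0 \<Lambda> (map \<omega> [0..<n])) (P (Suc n)) (\<lambda>z. fun_upd \<omega> n z))
    \<in> P n \<rightarrow>\<^sub>M subprob_algebra (P (Suc n))"
  by (rule measurable_distr2[OF measurable_upd bandit_step_kernel])

lemma measurable_upd1:
  assumes "\<omega> \<in> space (P n)"
  shows "(\<lambda>z. fun_upd \<omega> n z) \<in> obs_space \<mu> \<rightarrow>\<^sub>M P (Suc n)"
  using measurable_compose[OF measurable_Pair1'[OF assms] measurable_upd] by simp

lemma sets_bandit_step: "sets (bandit_step h \<mu> \<beta>0 \<Lambda> H) = sets (obs_space \<mu>)"
  unfolding bandit_step_eq by (rule sets_bind) auto

text \<open>Both claims share one induction: the bind at the next step uses the sigma-algebra of the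
  previous law and the fact that its space is nonempty.\<close>

lemma hist_sets_prob: "sets (hist n) = sets (P n) \<and> prob_space (hist n)"
proof (induction n)
  case 0
  show ?case by (auto intro!: prob_space_return simp: space_PiM)
next
  case (Suc n)
  then have s: "sets (hist n) = sets (P n)" and p: "prob_space (hist n)" by auto
  have sp: "space (hist n) = space (P n)" using s by (rule sets_eq_imp_space_eq)
  interpret prob_space "hist n" by (rule p)
  have k: "(\<lambda>\<omega>. distr (bandit_step h \<mu> \<beta>0 \<Lambda> (map \<omega> [0..<n])) (P (Suc n)) (\<lambda>z. fun_upd \<omega> n z))
    \<in> hist n \<rightarrow>\<^sub>M subprob_algebra (P (Suc n))"
    using hist_kernel measurable_cong_sets[OF s refl] by blast
  have "sets (hist (Suc n)) = sets (P (Suc n))"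
    unfolding bandit_hist.simps by (rule sets_bind) (auto simp: not_empty)
  moreover have "prob_space (hist (Suc n))"
    unfolding bandit_hist.simps
  proof (rule prob_space_bind[OF _ k], rule AE_I2)
    fix \<omega> assume "\<omega> \<in> space (hist n)"
    then have "(\<lambda>z. fun_upd \<omega> n z) \<in> bandit_step h \<mu> \<beta>0 \<Lambda> (map \<omega> [0..<n]) \<rightarrow>\<^sub>M P (Suc n)"
      using measurable_upd1 sp measurable_cong_sets[OF sets_bandit_step refl] by blast
    then show "prob_space (distr (bandit_step h \<mu> \<beta>0 \<Lambda> (map \<omega> [0..<n])) (P (Suc n)) (\<lambda>z. fun_upd \<omega> n z))"
      by (rule prob_space.prob_space_distr[OF prob_space_bandit_step])
  qed
  ultimately show ?case ..
qed

lemma sets_hist[measurable_cong]: "sets (hist n) = sets (P n)"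
  using hist_sets_prob by blast

lemma space_hist: "space (hist n) = space (P n)"
  by (rule sets_eq_imp_space_eq[OF sets_hist])

lemma prob_space_hist: "prob_space (hist n)"
  using hist_sets_prob by blast

text \<open>The tower property: the integrand on the right is the conditional expectation given the
  first \<open>n\<close> observations.\<close>

lemma nn_integral_hist_Suc:
  assumes f: "f \<in> borel_measurable (P (Suc n))"
  shows "(\<integral>\<^sup>+\<omega>. f \<omega> \<partial>hist (Suc n)) = (\<integral>\<^sup>+\<omega>. (\<Sum>k\<in>UNIV. ennreal (pmf (\<Lambda> (map \<omega> [0..<n])) k)
      * (\<integral>\<^sup>+y. f (fun_upd \<omega> n (k, y)) \<partial>arm k)) \<partial>hist n)"
proof -
  have k: "(\<lambda>\<omega>. distr (bandit_step h \<mu> \<beta>0 \<Lambda> (map \<omega> [0..<n])) (P (Suc n)) (\<lambda>z. fun_upd \<omega> n z))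
    \<in> hist n \<rightarrow>\<^sub>M subprob_algebra (P (Suc n))"
    using hist_kernel measurable_cong_sets[OF sets_hist refl] by blast
  show ?thesis
    unfolding bandit_hist.simps nn_integral_bind[OF f k]
  proof (rule nn_integral_cong)
    fix \<omega> assume "\<omega> \<in> space (hist n)"
    then have u: "(\<lambda>z. fun_upd \<omega> n z) \<in> obs_space \<mu> \<rightarrow>\<^sub>M P (Suc n)"
      using measurable_upd1 space_hist by blast
    then have u': "(\<lambda>z. fun_upd \<omega> n z) \<in> bandit_step h \<mu> \<beta>0 \<Lambda> (map \<omega> [0..<n]) \<rightarrow>\<^sub>M P (Suc n)"
      using measurable_cong_sets[OF sets_bandit_step refl] by blast
    show "(\<integral>\<^sup>+x. f x \<partial>distr (bandit_step h \<mu> \<beta>0 \<Lambda> (map \<omega> [0..<n])) (P (Suc n)) (\<lambda>z. fun_upd \<omega> n z))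
        = (\<Sum>k\<in>UNIV. ennreal (pmf (\<Lambda> (map \<omega> [0..<n])) k) * (\<integral>\<^sup>+y. f (fun_upd \<omega> n (k, y)) \<partial>arm k))"
      by (subst nn_integral_distr[OF u'], simp add: f, subst nn_integral_bandit_step)
         (use measurable_compose[OF u f] in auto)
  qed
qed

section \<open>Measurability of pull counts and reward sums\<close>

lemma measurable_arm_reward:
  assumes "j < n"
  shows "(\<lambda>\<omega>. fst (\<omega> j)) \<in> P n \<rightarrow>\<^sub>M count_space UNIV" "(\<lambda>\<omega>. snd (\<omega> j)) \<in> borel_measurable (P n)"
proof -
  have "(\<lambda>\<omega>. \<omega> j) \<in> P n \<rightarrow>\<^sub>M count_space UNIV \<Otimes>\<^sub>M \<mu>"
    using measurable_component_singleton[of j "{..<n}" "\<lambda>_. obs_space \<mu>"] assms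
    by (simp add: obs_space_def)
  from measurable_compose[OF this measurable_fst] measurable_compose[OF this measurable_snd]
  show "(\<lambda>\<omega>. fst (\<omega> j)) \<in> P n \<rightarrow>\<^sub>M count_space UNIV" "(\<lambda>\<omega>. snd (\<omega> j)) \<in> borel_measurable (P n)"
    using measurable_cong_sets[OF refl base] by auto
qed

lemma pulled_sets: "j < n \<Longrightarrow> {\<omega> \<in> space (P n). fst (\<omega> j) = i} \<in> sets (P n)"
  using measurable_compose[OF measurable_arm_reward(1), of j n "\<lambda>x. x = i" "count_space UNIV"]
  by (simp add: pred_def)

lemma measurable_num_pulls[measurable]: "(\<lambda>\<omega>. num_pulls n \<omega> i) \<in> P n \<rightarrow>\<^sub>M count_space UNIV"
  unfolding num_pulls_eq_sum
  by (intro measurable_sum_nat measurable_If measurable_const pulled_sets measurable_arm_reward) auto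

lemma measurable_ysum[measurable]: "(\<lambda>\<omega>. ysum n \<omega> i) \<in> borel_measurable (P n)"
  unfolding ysum_def
  by (intro borel_measurable_sum measurable_If measurable_const pulled_sets measurable_arm_reward) auto

text \<open>A martingale argument. Given the past, pulling another arm leaves the ratio unchanged,
  and pulling arm \<open>i\<close> multiplies it by a density ratio of mean 1. Every arm thus gives
  the same conditional expectation, so the choice made by \<open>\<Lambda>\<close> does not
  matter.\<close>

lemma nn_integral_likelihood_ratio:
  assumes l: "\<beta>0 $ i + l \<in> D"
  shows "(\<integral>\<^sup>+\<omega>. ennreal (exp (l * ysum n \<omega> i
      - real (num_pulls n \<omega> i) * (b (\<beta>0 $ i + l) - b (\<beta>0 $ i)))) \<partial>hist n) = 1"
proof (induction n)
  case 0
  interpret prob_space "hist 0" by (rule prob_space_hist)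
  show ?case using emeasure_space_1 by (simp add: ysum_def num_pulls_def del: bandit_hist.simps)
next
  case (Suc n)
  let ?\<Delta> = "b (\<beta>0 $ i + l) - b (\<beta>0 $ i)"
  let ?L = "\<lambda>n \<omega>. ennreal (exp (l * ysum n \<omega> i - real (num_pulls n \<omega> i) * ?\<Delta>))"
  have [measurable]: "?L (Suc n) \<in> borel_measurable (P (Suc n))" by measurable
  have step: "(\<integral>\<^sup>+y. ?L (Suc n) (fun_upd \<omega> n (k, y)) \<partial>arm k) = ?L n \<omega>" for \<omega> k
  proof (cases "k = i")
    case True
    have "(\<integral>\<^sup>+y. ?L (Suc n) (fun_upd \<omega> n (k, y)) \<partial>arm k) = (\<integral>\<^sup>+y. ?L n \<omega> * ennreal (exp (l * y - ?\<Delta>)) \<partial>arm k)"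
      using True by (intro nn_integral_cong)
        (simp add: num_pulls_upd ysum_upd algebra_simps flip: ennreal_mult exp_add)
    also have "\<dots> = ?L n \<omega> * (\<integral>\<^sup>+y. ennreal (exp (l * y - ?\<Delta>)) \<partial>arm k)"
      by (rule nn_integral_cmult) simp
    \<comment> \<open>The tilt turns the reward law at \<open>\<beta>0 $ i\<close> into the member
      of the family at \<open>\<beta>0 $ i + l\<close>.\<close>
    also have "(\<integral>\<^sup>+y. ennreal (exp (l * y - ?\<Delta>)) \<partial>arm k)
        = (\<integral>\<^sup>+y. ennreal (exp ((\<beta>0 $ i + l) * y - b (\<beta>0 $ i + l))) \<partial>\<nu>)"
      using True by (subst nn_integral_arm)
        (auto simp: algebra_simps simp flip: ennreal_mult exp_add intro!: nn_integral_cong)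
    also have "\<dots> = 1" by (rule nn_integral_exp_lognorm[OF l])
    finally show ?thesis unfolding mult_1_right .
  next
    case False
    interpret prob_space "arm k" by (rule prob_space_arm)
    show ?thesis using False emeasure_space_1 by (simp add: num_pulls_upd ysum_upd)
  qed
  have "(\<integral>\<^sup>+\<omega>. ?L (Suc n) \<omega> \<partial>hist (Suc n)) = (\<integral>\<^sup>+\<omega>. (\<Sum>k\<in>UNIV. ennreal (pmf (\<Lambda> (map \<omega> [0..<n])) k) * ?L n \<omega>) \<partial>hist n)"
    by (subst nn_integral_hist_Suc) (simp_all only: step, measurable)
  also have "\<dots> = (\<integral>\<^sup>+\<omega>. ?L n \<omega> \<partial>hist n)"
    by (simp add: sum_pmf_eq_1 flip: sum_distrib_right)
  also have "\<dots> = 1" by (rule Suc.IH)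
  finally show ?case .
qed

section \<open>Deviation bounds for the score under adaptive sampling\<close>

abbreviation score :: "nat \<Rightarrow> (nat \<Rightarrow> 'p \<times> real) \<Rightarrow> 'p \<Rightarrow> real" where
  "score n \<omega> i \<equiv> ysum n \<omega> i - real (num_pulls n \<omega> i) * deriv b (\<beta>0 $ i)"

text \<open>Fixing the exact value of \<open>num_pulls\<close> lets the tilt depend on it, so that a union bound
  replaces a maximal inequality.\<close>

lemma score_deviation:
  obtains c where "0 < c" "\<And>n m. 0 < m \<Longrightarrow>
    measure (hist n) {\<omega>\<in>space (hist n). num_pulls n \<omega> i = m \<and> \<bar>score n \<omega> i\<bar> > real m powr (5/8)}
      \<le> 2 * exp (- c * real m powr (1/4))"
proof -
  define \<eta> where "\<eta> = \<beta>0 $ i"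
  define v where "v = deriv (deriv b) \<eta>"
  obtain C r where Cr: "0 < v" "0 < C" "0 < r" and
    ex: "\<And>x. \<bar>x\<bar> \<le> r \<Longrightarrow> \<eta> + x \<in> D \<and> \<bar>b (\<eta> + x) - b \<eta> - deriv b \<eta> * x - v * x\<^sup>2 / 2\<bar> \<le> C * \<bar>x\<bar> ^ 3"
    using lognorm_expansion[OF interior[of i]] unfolding \<eta>_def v_def by blast
  \<comment> \<open>Merges the quadratic term and the cubic remainder into one quadratic bound on
    \<open>\<bar>x\<bar> \<le> r\<close>.\<close>
  define A where "A = v / 2 + C * r"
  have A: "0 < A" using Cr by (simp add: A_def add_pos_pos)
  have quad: "b (\<eta> + x) - b \<eta> - deriv b \<eta> * x \<le> A * x\<^sup>2" if "\<bar>x\<bar> \<le> r" for x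
  proof -
    have "C * \<bar>x\<bar> ^ 3 = C * \<bar>x\<bar> * x\<^sup>2" by (simp add: power3_eq_cube power2_eq_square abs_mult_self)
    also have "\<dots> \<le> C * r * x\<^sup>2" using that Cr by (intro mult_right_mono mult_left_mono) auto
    finally have "C * \<bar>x\<bar> ^ 3 \<le> C * r * x\<^sup>2" .
    moreover have "A * x\<^sup>2 = v * x\<^sup>2 / 2 + C * r * x\<^sup>2" by (simp add: A_def algebra_simps)
    ultimately show ?thesis using ex[OF that] by linarith
  qed
  \<comment> \<open>\<open>c \<le> r\<close> keeps the tilted parameter in \<open>D\<close>, and
    \<open>A * c \<le> 1 / 2\<close> makes the quadratic cost at most half of the linear
    gain.\<close>
  define c where "c = min r (1 / (2 * A))"
  have c: "0 < c" "c \<le> r" "A * c \<le> 1 / 2" using Cr A by (auto simp: c_def min_def field_simps)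
  have one_sided: "measure (hist n) {\<omega>\<in>space (hist n). num_pulls n \<omega> i = m \<and> s * score n \<omega> i > real m powr (5/8)}
      \<le> exp (- (c / 2) * real m powr (1/4))" if m: "0 < m" and s: "s = 1 \<or> s = -1" for n m and s :: real
  proof -
    interpret prob_space "hist n" by (rule prob_space_hist)
    \<comment> \<open>With this tilt the guaranteed gain in \<open>l * score n \<omega> i\<close>
      and the cost \<open>real m * (A * l\<^sup>2)\<close> are both of order
      \<open>m powr (1/4)\<close>. The sign \<open>s\<close> selects the tail.\<close>
    define l where "l = s * (c * real m powr (-(3/8)))"
    have al: "\<bar>l\<bar> = c * real m powr (-(3/8))" using s c by (auto simp: l_def abs_mult)
    have "real m powr (-(3/8)) \<le> 1" using m by (simp add: powr_minus ge_one_powr_ge_zero inverse_le_1_iff)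
    then have lr: "\<bar>l\<bar> \<le> r" using c mult_left_mono[of "real m powr (-(3/8))" 1 c] unfolding al by linarith
    let ?L = "\<lambda>\<omega>. exp (l * ysum n \<omega> i - real (num_pulls n \<omega> i) * (b (\<beta>0 $ i + l) - b (\<beta>0 $ i)))"
    let ?t = "exp (c / 2 * real m powr (1/4))"
    let ?S = "{\<omega>\<in>space (hist n). num_pulls n \<omega> i = m \<and> s * score n \<omega> i > real m powr (5/8)}"
    have S[measurable]: "?S \<in> sets (hist n)"
      unfolding sets_hist space_hist by measurable
    have big: "?t \<le> ?L \<omega>" if \<omega>: "num_pulls n \<omega> i = m" "s * score n \<omega> i > real m powr (5/8)" for \<omega>
    proof -
      have p1: "real m powr (-(3/8)) * real m powr (5/8) = real m powr (1/4)"
        using m by (simp flip: powr_add)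
      have p2: "real m * (real m powr (-(3/8)))\<^sup>2 = real m powr (1/4)"
        using m by (simp add: power2_eq_square flip: powr_add) (simp add: powr_mult_base)
      have "l * score n \<omega> i = (c * real m powr (-(3/8))) * (s * score n \<omega> i)" by (simp add: l_def)
      also have "\<dots> \<ge> (c * real m powr (-(3/8))) * real m powr (5/8)"
        using \<omega>(2) c by (intro mult_left_mono) auto
      finally have 1: "c * real m powr (1/4) \<le> l * score n \<omega> i" using p1 by (simp add: mult.assoc)
      have "l\<^sup>2 = c\<^sup>2 * (real m powr (-(3/8)))\<^sup>2" by (metis al power2_abs power_mult_distrib)
      then have "real m * (A * l\<^sup>2) = A * c * c * (real m * (real m powr (-(3/8)))\<^sup>2)"
        by (simp add: power2_eq_square)
      also have "\<dots> = (A * c) * (c * real m powr (1/4))" unfolding p2 by simp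
      also have "\<dots> \<le> 1 / 2 * (c * real m powr (1/4))" using c by (intro mult_right_mono) auto
      finally have "real m * (A * l\<^sup>2) \<le> c / 2 * real m powr (1/4)" by simp
      moreover have "real m * (b (\<eta> + l) - b \<eta> - deriv b \<eta> * l) \<le> real m * (A * l\<^sup>2)"
        using quad[OF lr] by (intro mult_left_mono) auto
      ultimately have "c / 2 * real m powr (1/4) \<le> l * score n \<omega> i - real m * (b (\<eta> + l) - b \<eta> - deriv b \<eta> * l)"
        using 1 by linarith
      also have "\<dots> = l * ysum n \<omega> i - real (num_pulls n \<omega> i) * (b (\<beta>0 $ i + l) - b (\<beta>0 $ i))"
        using \<omega>(1) by (simp add: \<eta>_def algebra_simps)
      finally show ?thesis by simp
    qed
    \<comment> \<open>Markov's inequality: the likelihood ratio is at least \<open>?t\<close> on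
      \<open>?S\<close> and has mean 1.\<close>
    have "ennreal ?t * emeasure (hist n) ?S = (\<integral>\<^sup>+\<omega>. ennreal ?t * indicator ?S \<omega> \<partial>hist n)"
      by (rule nn_integral_cmult_indicator[symmetric, OF S])
    also have "\<dots> \<le> (\<integral>\<^sup>+\<omega>. ennreal (?L \<omega>) \<partial>hist n)"
      by (intro nn_integral_mono) (use big in \<open>auto simp: indicator_def intro!: ennreal_leI\<close>)
    also have "\<dots> = 1" using ex[OF lr] by (intro nn_integral_likelihood_ratio) (simp add: \<eta>_def)
    finally have "?t * measure (hist n) ?S \<le> 1"
      by (simp add: emeasure_eq_measure flip: ennreal_mult ennreal_1)
    then show ?thesis by (simp add: exp_minus field_simps)
  qed
  have "measure (hist n) {\<omega>\<in>space (hist n). num_pulls n \<omega> i = m \<and> \<bar>score n \<omega> i\<bar> > real m powr (5/8)}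
      \<le> 2 * exp (- (c / 2) * real m powr (1/4))" if m: "0 < m" for n m
  proof -
    interpret prob_space "hist n" by (rule prob_space_hist)
    let ?S = "\<lambda>s::real. {\<omega>\<in>space (hist n). num_pulls n \<omega> i = m \<and> s * score n \<omega> i > real m powr (5/8)}"
    have "?S s \<in> sets (hist n)" for s unfolding sets_hist space_hist by measurable
    then have "measure (hist n) (?S 1 \<union> ?S (-1)) \<le> measure (hist n) (?S 1) + measure (hist n) (?S (-1))"
      by (intro measure_Un_le) auto
    also have "\<dots> \<le> 2 * exp (- (c / 2) * real m powr (1/4))"
      using one_sided[OF m, of 1 n] one_sided[OF m, of "-1" n] by auto
    also have "?S 1 \<union> ?S (-1) = {\<omega>\<in>space (hist n). num_pulls n \<omega> i = m \<and> \<bar>score n \<omega> i\<bar> > real m powr (5/8)}"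
      by (auto simp: abs_if)
    finally show ?thesis .
  qed
  then show thesis using that[of "c / 2"] c by simp
qed

text \<open>Union bound over the exact pull counts from \<open>M\<close> on. The individual bounds
  do not involve \<open>n\<close>, so the tail of one convergent series serves all
  \<open>n\<close>.\<close>

lemma score_deviation_tail:
  obtains T :: "nat \<Rightarrow> real" where "T \<longlonglongrightarrow> 0" "\<And>n M. 0 < M \<Longrightarrow> measure (hist n)
    {\<omega>\<in>space (hist n). M \<le> num_pulls n \<omega> i \<and> \<bar>score n \<omega> i\<bar> > real (num_pulls n \<omega> i) powr (5/8)} \<le> T M"
proof -
  obtain c where c: "0 < c" and dev: "\<And>n m. 0 < m \<Longrightarrow>
    measure (hist n) {\<omega>\<in>space (hist n). num_pulls n \<omega> i = m \<and> \<bar>score n \<omega> i\<bar> > real m powr (5/8)}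
      \<le> 2 * exp (- c * real m powr (1/4))"
    using score_deviation[of i] by blast
  define q where "q = (\<lambda>m. 2 * exp (- c * real m powr (1/4)))"
  have "summable q"
  proof (rule summable_comparison_test_ev)
    have "\<forall>\<^sub>F m in sequentially. 2 * exp (- c * real m powr (1/4)) \<le> real m powr (-2)"
      using c by real_asymp
    then show "\<forall>\<^sub>F m in sequentially. norm (q m) \<le> real m powr (-2)" by (simp add: q_def)
    show "summable (\<lambda>m. real m powr (-2))" by (simp add: summable_real_powr_iff)
  qed
  show thesis
  proof (rule that)
    show "(\<lambda>M. \<Sum>k. q (k + M)) \<longlonglongrightarrow> 0" by (rule suminf_exist_split2[OF \<open>summable q\<close>])
    fix n M :: nat assume M: "0 < M"
    interpret prob_space "hist n" by (rule prob_space_hist)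
    let ?S = "\<lambda>m. {\<omega>\<in>space (hist n). num_pulls n \<omega> i = m \<and> \<bar>score n \<omega> i\<bar> > real m powr (5/8)}"
    have "?S m \<in> sets (hist n)" for m unfolding sets_hist space_hist by measurable
    \<comment> \<open>A count never exceeds \<open>n\<close>, so the values \<open>k + M\<close>
      with \<open>k \<le> n\<close> exhaust the event.\<close>
    then have "measure (hist n) (\<Union>k\<in>{..n}. ?S (k + M)) \<le> (\<Sum>k\<le>n. measure (hist n) (?S (k + M)))"
      by (intro measure_UNION_le) auto
    also have "\<dots> \<le> (\<Sum>k\<le>n. q (k + M))"
      unfolding q_def using M by (intro sum_mono dev) auto
    also have "\<dots> \<le> (\<Sum>k. q (k + M))"
      using summable_ignore_initial_segment[OF \<open>summable q\<close>] by (intro sum_le_suminf) (auto simp: q_def)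
    also have "(\<Union>k\<in>{..n}. ?S (k + M)) = {\<omega>\<in>space (hist n). M \<le> num_pulls n \<omega> i
        \<and> \<bar>score n \<omega> i\<bar> > real (num_pulls n \<omega> i) powr (5/8)}"
    proof (intro set_eqI iffI)
      fix \<omega> assume *: "\<omega> \<in> {\<omega>\<in>space (hist n). M \<le> num_pulls n \<omega> i \<and> \<bar>score n \<omega> i\<bar> > real (num_pulls n \<omega> i) powr (5/8)}"
      then have "\<omega> \<in> ?S ((num_pulls n \<omega> i - M) + M)" by simp
      moreover have "num_pulls n \<omega> i - M \<in> {..n}" using num_pulls_le[of n \<omega> i] by simp
      ultimately show "\<omega> \<in> (\<Union>k\<in>{..n}. ?S (k + M))" by blast
    qed auto
    finally show "measure (hist n) {\<omega>\<in>space (hist n). M \<le> num_pulls n \<omega> i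
        \<and> \<bar>score n \<omega> i\<bar> > real (num_pulls n \<omega> i) powr (5/8)} \<le> (\<Sum>k. q (k + M))" .
  qed
qed

end

section \<open>The posterior\<close>

context bandit
begin

text \<open>The Laplace approximation translated to \<open>\<eta>\<close>. There
  \<open>\<Psi>\<close> is the excess of \<open>b\<close> over its tangent at \<open>\<eta>\<close>;
  removing an affine part preserves convexity and corresponds to centring the rewards.\<close>

lemma arm_laplace:
  fixes i :: 'p and \<epsilon> r :: real
  assumes "0 < \<epsilon>" "0 < r"
  defines "\<eta> \<equiv> \<beta>0 $ i" and "v \<equiv> deriv (deriv b) (\<beta>0 $ i)"
  shows "\<forall>\<^sub>F N in at_top. \<forall>S. \<bar>S\<bar> \<le> N powr (5/8) \<longrightarrow>
    (\<integral>\<^sup>+x. ennreal \<bar>indicator D x * exp (S * (x - \<eta>) - N * (b x - b \<eta> - deriv b \<eta> * (x - \<eta>)))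
          / (sqrt (2 * pi / (N * v)) * exp (S\<^sup>2 / (2 * N * v)))
        - normal_density (\<eta> + S / (N * v)) (sqrt (1 / (N * v))) x\<bar> \<partial>lborel) \<le> ennreal \<epsilon> \<and>
    (\<integral>\<^sup>+x. ennreal (normal_density (\<eta> + S / (N * v)) (sqrt (1 / (N * v))) x)
        * indicator {x. r \<le> \<bar>x - \<eta>\<bar>} x \<partial>lborel) \<le> ennreal \<epsilon>"
proof -
  define \<Psi> where "\<Psi> = (\<lambda>x. b (\<eta> + x) - b \<eta> - deriv b \<eta> * x)"
  define E where "E = {x. \<eta> + x \<in> D}"
  have [measurable]: "D \<in> sets borel" "b \<in> borel_measurable borel"
    using measurable_natspace_lognorm[OF \<beta>0_natspace] by auto
  have [measurable]: "E \<in> sets borel" unfolding E_def by measurable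
  have [measurable]: "\<Psi> \<in> borel_measurable borel" unfolding \<Psi>_def by measurable
  obtain C r0 where C: "0 < v" "0 < C" "0 < r0"
    "\<And>x. \<bar>x\<bar> \<le> r0 \<Longrightarrow> \<eta> + x \<in> D \<and> \<bar>b (\<eta> + x) - b \<eta> - deriv b \<eta> * x - v * x\<^sup>2 / 2\<bar> \<le> C * \<bar>x\<bar> ^ 3"
    using lognorm_expansion[OF interior[of i]] unfolding \<eta>_def v_def by blast
  have cvx: "convex_on E \<Psi>"
  proof (rule convex_onI)
    have mix: "\<eta> + ((1 - t) *\<^sub>R x + t *\<^sub>R y) = (1 - t) *\<^sub>R (\<eta> + x) + t *\<^sub>R (\<eta> + y)" for t x y :: real
      by (simp add: algebra_simps)
    show "\<Psi> ((1 - t) *\<^sub>R x + t *\<^sub>R y) \<le> (1 - t) * \<Psi> x + t * \<Psi> y"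
      if "0 < t" "t < 1" "x \<in> E" "y \<in> E" for t x y
    proof -
      have "b (\<eta> + ((1 - t) *\<^sub>R x + t *\<^sub>R y)) \<le> (1 - t) * b (\<eta> + x) + t * b (\<eta> + y)"
        unfolding mix using that by (intro convex_onD[OF convex_lognorm]) (auto simp: E_def)
      then show ?thesis by (simp add: \<Psi>_def algebra_simps)
    qed
    show "convex E"
      unfolding convex_alt
    proof (intro ballI allI impI)
      fix x y t :: real assume "x \<in> E" "y \<in> E" "0 \<le> t \<and> t \<le> 1"
      then have "(1 - t) *\<^sub>R (\<eta> + x) + t *\<^sub>R (\<eta> + y) \<in> D"
        using convex_on_imp_convex[OF convex_lognorm] unfolding convex_alt by (auto simp: E_def)
      then show "(1 - t) *\<^sub>R x + t *\<^sub>R y \<in> E" by (simp only: E_def mem_Collect_eq mix)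
    qed
  qed
  have "\<forall>x. \<bar>x\<bar> \<le> r0 \<longrightarrow> x \<in> E \<and> \<bar>\<Psi> x - v * x\<^sup>2 / 2\<bar> \<le> C * \<bar>x\<bar> ^ 3"
    using C(4) by (simp add: E_def \<Psi>_def)
  note lap = laplace_approximation[OF cvx \<open>E \<in> sets borel\<close> \<open>\<Psi> \<in> borel_measurable borel\<close> C(1-3) assms(2,1) this]
  have shift: "(\<integral>\<^sup>+x. F x \<partial>lborel) = (\<integral>\<^sup>+x. F (\<eta> + x) \<partial>lborel)"
    if "F \<in> borel_measurable borel" for F :: "real \<Rightarrow> ennreal"
    using nn_integral_real_affine[OF that, of 1 \<eta>] by simp
  have nd: "normal_density (\<eta> + m) s (\<eta> + x) = normal_density m s x" for m s x
    by (simp add: normal_density_def)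
  have ind: "indicator D (\<eta> + x) = (indicator E x :: real)" for x by (simp add: E_def indicator_def)
  have ind2: "indicator {x. r \<le> \<bar>x - \<eta>\<bar>} (\<eta> + x) = (indicator {x. r \<le> \<bar>x\<bar>} x :: ennreal)" for x
    by (simp add: indicator_def)
  from lap show ?thesis
  proof eventually_elim
    case (elim N)
    show ?case
      by (subst shift, measurable, subst (2) shift, measurable)
         (use elim in \<open>simp add: nd ind ind2 \<Psi>_def\<close>)
  qed
qed

text \<open>The deterministic half: many pulls and a moderate score for every arm suffice, with a
  threshold \<open>M\<close> that depends on neither \<open>n\<close> nor the history.\<close>

lemma posterior_close_to_gauss:
  assumes prior_nonneg: "\<And>\<beta>. prior \<beta> \<ge> 0"
    and prior_supp: "\<And>\<beta>. (\<exists>i. \<beta> $ i \<notin> natspace h \<mu>) \<Longrightarrow> prior \<beta> = 0"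
    and prior_cont: "continuous_on UNIV prior"
    and prior_bdd: "bounded (range prior)"
    and prior_pos: "prior \<beta>0 > 0" and "0 < \<epsilon>"
  obtains M :: nat where "0 < M" "\<And>n \<omega>. (\<And>i. M \<le> num_pulls n \<omega> i) \<Longrightarrow>
    (\<And>i. \<bar>score n \<omega> i\<bar> \<le> real (num_pulls n \<omega> i) powr (5/8)) \<Longrightarrow>
    tv_dist (posterior h \<mu> prior n \<omega>) (gauss_approx h \<mu> \<beta>0 n \<omega>) \<le> \<epsilon>"
proof -
  have [measurable]: "prior \<in> borel_measurable borel"
    using prior_cont by (rule borel_measurable_continuous_onI)
  have [measurable]: "D \<in> sets borel" "b \<in> borel_measurable borel"
    using measurable_natspace_lognorm[OF \<beta>0_natspace] by auto
  obtain B where B: "0 < B" "\<And>\<beta>. prior \<beta> \<le> B"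
    using prior_bdd unfolding bounded_pos by (auto simp: abs_le_iff)
  define p where "p = real CARD('p)"
  have p: "1 \<le> p" by (simp add: p_def Suc_le_eq)
  \<comment> \<open>The first bound keeps the normaliser away from 0, the second gives
    \<open>4 * \<theta> / prior \<beta>0 \<le> \<epsilon>\<close>. Half of \<open>\<theta>0\<close>
    is spent on \<open>\<tau>\<close>, half on \<open>H * e\<close>.\<close>
  define \<theta>0 where "\<theta>0 = min (prior \<beta>0 / 2) (\<epsilon> * prior \<beta>0 / 4)"
  have \<theta>0: "0 < \<theta>0" using prior_pos \<open>0 < \<epsilon>\<close> by (simp add: \<theta>0_def)
  define \<tau> where "\<tau> = \<theta>0 / 2"
  define H where "H = B * (p * 2 ^ CARD('p)) + B * p"
  have H: "0 < H" using B p by (simp add: H_def add_pos_pos)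
  define e where "e = min 1 (\<theta>0 / (2 * H))"
  have e: "0 < e" "e \<le> 1" "H * e \<le> \<theta>0 / 2"
    using \<theta>0 H by (auto simp: e_def min_def field_simps)
  define \<theta> where "\<theta> = B * (p * (2 ^ CARD('p) * e)) + (\<tau> + B * (p * e))"
  have \<theta>: "\<theta> \<le> \<theta>0"
  proof -
    have "\<theta> = \<tau> + H * e" by (simp add: \<theta>_def H_def algebra_simps)
    then show ?thesis using e(3) by (simp add: \<tau>_def)
  qed
  obtain d where d: "0 < d" "\<And>x. dist x \<beta>0 < d \<Longrightarrow> dist (prior x) (prior \<beta>0) < \<tau>"
    using prior_cont \<theta>0 unfolding continuous_on_iff \<tau>_def by (metis UNIV_I half_gt_zero)
  \<comment> \<open>The norm is at most the sum of the \<open>p\<close> coordinate distances, so the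
    open box of half-width \<open>d / p\<close> lies in the ball of radius \<open>d\<close>.\<close>
  define r where "r = d / p"
  have r: "0 < r" using d p by (simp add: r_def)
  have close: "\<bar>prior x - prior \<beta>0\<bar> \<le> \<tau>" if x: "\<And>i. \<bar>x $ i - \<beta>0 $ i\<bar> < r" for x
  proof -
    have "dist x \<beta>0 \<le> (\<Sum>i\<in>UNIV. \<bar>(x - \<beta>0) $ i\<bar>)"
      unfolding dist_norm by (rule norm_le_l1_cart)
    also have "\<dots> < (\<Sum>i\<in>(UNIV::'p set). r)" using x by (intro sum_strict_mono) auto
    also have "\<dots> = d" using p by (simp add: r_def p_def)
    finally show ?thesis using d(2)[of x] by (simp add: dist_real_def)
  qed
  let ?v = "\<lambda>i. deriv (deriv b) (\<beta>0 $ i)"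
  define K where "K = (\<lambda>i N S. sqrt (2 * pi / (N * ?v i)) * exp (S\<^sup>2 / (2 * N * ?v i)))"
  define f where "f = (\<lambda>i N S x. indicator D x
    * exp (S * (x - \<beta>0 $ i) - N * (b x - b (\<beta>0 $ i) - deriv b (\<beta>0 $ i) * (x - \<beta>0 $ i))) / K i N S)"
  define g where "g = (\<lambda>i N S. normal_density (\<beta>0 $ i + S / (N * ?v i)) (sqrt (1 / (N * ?v i))))"
  have "\<forall>\<^sub>F N in at_top. \<forall>i S. \<bar>S\<bar> \<le> N powr (5/8) \<longrightarrow>
    (\<integral>\<^sup>+x. ennreal \<bar>f i N S x - g i N S x\<bar> \<partial>lborel) \<le> ennreal e \<and>
    (\<integral>\<^sup>+x. ennreal (g i N S x) * indicator {x. r \<le> \<bar>x - \<beta>0 $ i\<bar>} x \<partial>lborel) \<le> ennreal e"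
    unfolding f_def g_def K_def by (rule eventually_all_finite, rule arm_laplace[OF e(1) r])
  \<comment> \<open>The threshold is uniform over the finitely many arms and over all admissible
    \<open>S\<close>.\<close>
  then obtain M0 where M0: "\<And>i N S. M0 \<le> N \<Longrightarrow> \<bar>S\<bar> \<le> N powr (5/8) \<Longrightarrow>
    (\<integral>\<^sup>+x. ennreal \<bar>f i N S x - g i N S x\<bar> \<partial>lborel) \<le> ennreal e \<and>
    (\<integral>\<^sup>+x. ennreal (g i N S x) * indicator {x. r \<le> \<bar>x - \<beta>0 $ i\<bar>} x \<partial>lborel) \<le> ennreal e"
    unfolding eventually_at_top_linorder by blast
  \<comment> \<open>The maximum with 1 makes every count positive, so empirical means and Gaussian
    variances are genuine quotients, not default values of division by zero.\<close>
  define M where "M = max 1 (nat \<lceil>M0\<rceil>)"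
  have v: "0 < ?v i" for i by (rule lognorm_expansion[OF interior])
  show thesis
  proof (rule that)
    show "0 < M" by (simp add: M_def)
    fix n and \<omega> :: "nat \<Rightarrow> 'p \<times> real"
    assume N: "\<And>i. M \<le> num_pulls n \<omega> i"
      and S: "\<And>i. \<bar>score n \<omega> i\<bar> \<le> real (num_pulls n \<omega> i) powr (5/8)"
    let ?N = "\<lambda>i. real (num_pulls n \<omega> i)" and ?S = "\<lambda>i. score n \<omega> i"
    have N0: "0 < ?N i" and NM: "M0 \<le> ?N i" for i
      using N[of i] by (auto simp: M_def)
    have K: "0 < K i (?N i) (?S i)" for i
      using N0[of i] v[of i] by (simp add: K_def)
    have fg_meas[measurable]: "f i (?N i) (?S i) \<in> borel_measurable borel"
      "g i (?N i) (?S i) \<in> borel_measurable borel" for i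
      unfolding f_def g_def by measurable
    have g1: "(\<integral>\<^sup>+x. ennreal (g i (?N i) (?S i) x) \<partial>lborel) = 1" for i
    proof -
      interpret prob_space "density lborel (g i (?N i) (?S i))"
        unfolding g_def using N0[of i] v[of i] by (intro prob_space_normal_density) auto
      show ?thesis using emeasure_space_1 by (simp add: emeasure_density)
    qed
    \<comment> \<open>Collects the factors free of the parameter: the normalisers of the arms and
      the likelihood at \<open>\<beta>0\<close>.\<close>
    define Kc where "Kc = (\<Prod>i\<in>UNIV. K i (?N i) (?S i) * exp (\<beta>0 $ i * ysum n \<omega> i - ?N i * b (\<beta>0 $ i)))"
    have lik: "prior \<beta> * likelihood h \<mu> n \<omega> \<beta> = Kc * (prior \<beta> * (\<Prod>i\<in>UNIV. f i (?N i) (?S i) (\<beta> $ i)))" for \<beta>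
    proof (cases "\<forall>i. \<beta> $ i \<in> D")
      case True
      have "exp (\<beta> $ i * ysum n \<omega> i - ?N i * b (\<beta> $ i))
          = K i (?N i) (?S i) * exp (\<beta>0 $ i * ysum n \<omega> i - ?N i * b (\<beta>0 $ i)) * f i (?N i) (?S i) (\<beta> $ i)" for i
        using True K[of i] by (simp add: f_def algebra_simps flip: exp_add)
      then show ?thesis unfolding likelihood_eq Kc_def by (simp add: prod.distrib)
    next
      case False
      then have "prior \<beta> = 0" by (intro prior_supp) auto
      then show ?thesis by simp
    qed
    \<comment> \<open>The offset of the local MLE is score over information, which is exactly the
      centre of the Gaussian in the Laplace approximation.\<close>
    have mle: "local_mle h \<mu> \<beta>0 n \<omega> $ i = \<beta>0 $ i + ?S i / (?N i * ?v i)" for i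
      using N0[of i] v[of i] by (simp add: local_mle_def ybar_eq field_simps)
    have "tv_dist (density lborel (\<lambda>\<beta>. ennreal (prior \<beta> * likelihood h \<mu> n \<omega> \<beta>
          / (\<integral>\<beta>'. prior \<beta>' * likelihood h \<mu> n \<omega> \<beta>' \<partial>lborel))))
        (density lborel (\<lambda>\<beta>. ennreal (\<Prod>i\<in>UNIV. g i (?N i) (?S i) (\<beta> $ i)))) \<le> 4 * \<theta> / prior \<beta>0"
    proof (rule tv_dist_reweighted_product_le[where B = B and e = e and \<tau> = \<tau> and r = r and K = Kc
          and f = "\<lambda>i. f i (?N i) (?S i)" and g = "\<lambda>i. g i (?N i) (?S i)"
          and w = "\<lambda>\<beta>. prior \<beta> * likelihood h \<mu> n \<omega> \<beta>" and prior = prior])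
      show "0 \<le> f i (?N i) (?S i) x" for i x using K[of i] by (simp add: f_def)
      show "0 \<le> g i (?N i) (?S i) x" for i x by (simp add: g_def)
      show "\<theta> = B * (CARD('p) * (2 ^ CARD('p) * e)) + (\<tau> + B * (CARD('p) * e))"
        by (simp add: \<theta>_def p_def)
      show "0 < Kc" unfolding Kc_def using K by (intro prod_pos) simp
      show "\<theta> \<le> prior \<beta>0 / 2" using \<theta> by (simp add: \<theta>0_def)
      show "0 \<le> \<tau>" using \<theta>0 by (simp add: \<tau>_def)
      show "0 \<le> e" "e \<le> 1" using e by auto
      show "(\<integral>\<^sup>+x. ennreal \<bar>f i (?N i) (?S i) x - g i (?N i) (?S i) x\<bar> \<partial>lborel) \<le> ennreal e"
        "(\<integral>\<^sup>+x. ennreal (g i (?N i) (?S i) x) * indicator {x. r \<le> \<bar>x - \<beta>0 $ i\<bar>} x \<partial>lborel) \<le> ennreal e" for i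
        using M0[OF NM[of i] S[of i], of i] by (rule conjunct1, rule conjunct2)
      show "prior \<in> borel_measurable borel" by measurable
      show "\<bar>prior x - prior \<beta>0\<bar> \<le> \<tau>" if "\<And>i. \<bar>x $ i - \<beta>0 $ i\<bar> < r" for x
        using that by (rule close)
    qed (rule prior_nonneg prior_pos B(2) lik g1 fg_meas)+
    also have "4 * \<theta> / prior \<beta>0 \<le> \<epsilon>"
      using \<theta> prior_pos by (simp add: \<theta>0_def field_simps)
    finally show "tv_dist (posterior h \<mu> prior n \<omega>) (gauss_approx h \<mu> \<beta>0 n \<omega>) \<le> \<epsilon>"
      by (simp add: posterior_def gauss_approx_def mle g_def)
  qed
qed

end

text \<open>Convergence is stated in outer probability: the bad event is covered by measurable sets
  \<open>A n\<close> of vanishing probability, so measurability of the total variation distance in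
  the history is not presupposed.\<close>

theorem theorem3:
  fixes h :: "real \<Rightarrow> real" and \<mu> :: "real measure"
    and \<beta>0 :: "real ^ 'p" and \<Lambda> :: "('p \<times> real) list \<Rightarrow> 'p pmf"
    and prior :: "real ^ 'p \<Rightarrow> real"
  assumes base: "sets \<mu> = sets borel"
    and h_meas: "h \<in> borel_measurable \<mu>" and h_nonneg: "\<And>y. h y \<ge> 0"
    and nondegenerate: "\<And>c. \<not> (AE y in \<mu>. h y \<noteq> 0 \<longrightarrow> y = c)"
    and \<Lambda>_meas: "\<And>n i. (\<lambda>\<omega>. pmf (\<Lambda> (map \<omega> [0..<n])) i)
                        \<in> borel_measurable (PiM {..<n} (\<lambda>_. obs_space \<mu>))"
    and interior: "\<And>i. \<beta>0 $ i \<in> interior (natspace h \<mu>)"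
    and pulls: "\<And>M::real. (\<lambda>n. measure (bandit_hist h \<mu> \<beta>0 \<Lambda> n)
                  {\<omega> \<in> space (bandit_hist h \<mu> \<beta>0 \<Lambda> n).
                     real (Min (range (num_pulls n \<omega>))) \<le> M}) \<longlonglongrightarrow> 0"
    and prior_nonneg: "\<And>\<beta>. prior \<beta> \<ge> 0"
    and prior_int: "integrable lborel prior" "(\<integral>\<beta>. prior \<beta> \<partial>lborel) = 1"
    and prior_supp: "\<And>\<beta>. (\<exists>i. \<beta> $ i \<notin> natspace h \<mu>) \<Longrightarrow> prior \<beta> = 0"
    and prior_cont: "continuous_on UNIV prior"
    and prior_bdd: "bounded (range prior)"
    and prior_pos: "prior \<beta>0 > 0"
  shows "\<forall>\<epsilon>>0. \<exists>A. (\<forall>n. A n \<in> sets (bandit_hist h \<mu> \<beta>0 \<Lambda> n) \<and>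
             {\<omega> \<in> space (bandit_hist h \<mu> \<beta>0 \<Lambda> n).
                tv_dist (posterior h \<mu> prior n \<omega>) (gauss_approx h \<mu> \<beta>0 n \<omega>) > \<epsilon>} \<subseteq> A n)
           \<and> (\<lambda>n. measure (bandit_hist h \<mu> \<beta>0 \<Lambda> n) (A n)) \<longlonglongrightarrow> 0"
proof (intro allI impI)
  fix \<epsilon> :: real assume "0 < \<epsilon>"
  interpret bandit h \<mu> \<beta>0 \<Lambda>
    using base h_meas h_nonneg nondegenerate \<Lambda>_meas interior by unfold_locales
  obtain M0 where M0: "0 < M0" "\<And>n \<omega>. (\<And>i. M0 \<le> num_pulls n \<omega> i) \<Longrightarrow>
      (\<And>i. \<bar>score n \<omega> i\<bar> \<le> real (num_pulls n \<omega> i) powr (5/8)) \<Longrightarrow>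
      tv_dist (posterior h \<mu> prior n \<omega>) (gauss_approx h \<mu> \<beta>0 n \<omega>) \<le> \<epsilon>"
    using posterior_close_to_gauss[OF prior_nonneg prior_supp prior_cont prior_bdd prior_pos \<open>0 < \<epsilon>\<close>] by blast
  define A where "A = (\<lambda>n. {\<omega>\<in>space (hist n). \<exists>i. num_pulls n \<omega> i < M0
      \<or> \<bar>score n \<omega> i\<bar> > real (num_pulls n \<omega> i) powr (5/8)})"
  have A_sets: "A n \<in> sets (hist n)" for n
    unfolding A_def sets_hist space_hist by measurable
  have A_sup: "{\<omega> \<in> space (hist n). tv_dist (posterior h \<mu> prior n \<omega>) (gauss_approx h \<mu> \<beta>0 n \<omega>) > \<epsilon>} \<subseteq> A n" for n
  proof
    fix \<omega> assume \<omega>: "\<omega> \<in> {\<omega> \<in> space (hist n). tv_dist (posterior h \<mu> prior n \<omega>) (gauss_approx h \<mu> \<beta>0 n \<omega>) > \<epsilon>}"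
    show "\<omega> \<in> A n"
    proof (rule ccontr)
      assume "\<omega> \<notin> A n"
      then have "M0 \<le> num_pulls n \<omega> i \<and> \<bar>score n \<omega> i\<bar> \<le> real (num_pulls n \<omega> i) powr (5/8)" for i
        using \<omega> by (auto simp: A_def not_less)
      then show False using M0(2)[of n \<omega>] \<omega> by auto
    qed
  qed
  \<comment> \<open>A named predicate lets one sequence \<open>T i\<close> be chosen for each
    arm.\<close>
  define tail where "tail = (\<lambda>i T. T \<longlonglongrightarrow> (0::real) \<and> (\<forall>n M. 0 < M \<longrightarrow> measure (hist n)
    {\<omega>\<in>space (hist n). M \<le> num_pulls n \<omega> i \<and> \<bar>score n \<omega> i\<bar> > real (num_pulls n \<omega> i) powr (5/8)} \<le> T M))"
  have "\<exists>T. tail i T" for i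
    unfolding tail_def by (rule score_deviation_tail[of i]) blast
  then obtain T where "tail i (T i)" for i by metis
  then have T: "\<And>i. T i \<longlonglongrightarrow> 0" "\<And>i n M. 0 < M \<Longrightarrow> measure (hist n)
    {\<omega>\<in>space (hist n). M \<le> num_pulls n \<omega> i \<and> \<bar>score n \<omega> i\<bar> > real (num_pulls n \<omega> i) powr (5/8)} \<le> T i M"
    unfolding tail_def by blast+
  define U where "U = (\<lambda>n (M::nat). {\<omega> \<in> space (hist n). real (Min (range (num_pulls n \<omega>))) \<le> real M})"
  \<comment> \<open>\<open>M\<close> is free above \<open>M0\<close>: a count of at most
    \<open>M\<close> is charged to the event in \<open>pulls\<close>, a larger count with a bad
    score to the summable tail. Later \<open>M\<close> is fixed first, and then \<open>n\<close>
    grows.\<close>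
  have bound: "measure (hist n) (A n) \<le> measure (hist n) (U n M) + (\<Sum>i\<in>UNIV. T i M)" if M: "M0 \<le> M" for n M
  proof -
    interpret prob_space "hist n" by (rule prob_space_hist)
    let ?V = "\<lambda>i. {\<omega>\<in>space (hist n). M \<le> num_pulls n \<omega> i \<and> \<bar>score n \<omega> i\<bar> > real (num_pulls n \<omega> i) powr (5/8)}"
    have Ueq: "U n M = {\<omega>\<in>space (hist n). \<exists>i. num_pulls n \<omega> i \<le> M}"
      by (auto simp: U_def Min_le_iff)
    have U[measurable]: "U n M \<in> sets (hist n)"
      unfolding Ueq sets_hist space_hist by measurable
    have V[measurable]: "?V i \<in> sets (hist n)" for i
      unfolding sets_hist space_hist by measurable
    have "A n \<subseteq> U n M \<union> (\<Union>i\<in>UNIV. ?V i)"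
    proof
      fix \<omega> assume "\<omega> \<in> A n"
      then obtain i where "\<omega> \<in> space (hist n)"
        "num_pulls n \<omega> i < M0 \<or> \<bar>score n \<omega> i\<bar> > real (num_pulls n \<omega> i) powr (5/8)"
        by (auto simp: A_def)
      then show "\<omega> \<in> U n M \<union> (\<Union>i\<in>UNIV. ?V i)"
        using M unfolding Ueq by (cases "num_pulls n \<omega> i \<le> M") auto
    qed
    then have "measure (hist n) (A n) \<le> measure (hist n) (U n M \<union> (\<Union>i\<in>UNIV. ?V i))"
      by (intro finite_measure_mono) auto
    also have "\<dots> \<le> measure (hist n) (U n M) + measure (hist n) (\<Union>i\<in>UNIV. ?V i)"
      by (intro measure_Un_le) auto
    also have "measure (hist n) (\<Union>i\<in>UNIV. ?V i) \<le> (\<Sum>i\<in>UNIV. measure (hist n) (?V i))"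
      by (intro measure_UNION_le) auto
    also have "\<dots> \<le> (\<Sum>i\<in>UNIV. T i M)"
      using M M0(1) by (intro sum_mono T(2)) auto
    finally show ?thesis by simp
  qed
  have "(\<lambda>n. measure (hist n) (A n)) \<longlonglongrightarrow> 0"
  proof (rule order_tendstoI)
    fix e :: real assume e: "0 < e"
    have "(\<lambda>M. \<Sum>i\<in>UNIV. T i M) \<longlonglongrightarrow> 0"
      using tendsto_sum[of UNIV T "\<lambda>_. 0" sequentially] T(1) by simp
    then have "\<forall>\<^sub>F M in sequentially. (\<Sum>i\<in>UNIV. T i M) < e / 2"
      using e by (intro order_tendstoD) auto
    then have "\<forall>\<^sub>F M in sequentially. (\<Sum>i\<in>UNIV. T i M) < e / 2 \<and> M0 \<le> M"
      using eventually_ge_at_top[of M0] by (rule eventually_conj)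
    then obtain M where M: "(\<Sum>i\<in>UNIV. T i M) < e / 2" "M0 \<le> M"
      by (auto simp: eventually_sequentially)
    have "\<forall>\<^sub>F n in sequentially. measure (hist n) (U n M) < e / 2"
      unfolding U_def using e by (intro order_tendstoD(2)[OF pulls]) auto
    then show "\<forall>\<^sub>F n in sequentially. measure (hist n) (A n) < e"
    proof eventually_elim
      case (elim n)
      then show ?case using bound[OF M(2), of n] M(1) by linarith
    qed
  next
    fix e :: real assume "e < 0"
    then show "\<forall>\<^sub>F n in sequentially. e < measure (hist n) (A n)"
      by (simp add: less_le_trans[OF _ measure_nonneg])
  qed
  then show "\<exists>A. (\<forall>n. A n \<in> sets (hist n) \<and>
      {\<omega> \<in> space (hist n). tv_dist (posterior h \<mu> prior n \<omega>) (gauss_approx h \<mu> \<beta>0 n \<omega>) > \<epsilon>} \<subseteq> A n)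
      \<and> (\<lambda>n. measure (hist n) (A n)) \<longlonglongrightarrow> 0"
    by (intro exI[of _ A] conjI allI A_sets A_sup)
qed

end
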